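(* Let $k$, $(U,Q)$, $f$, $L$, $\beta$, $\langle\,,\rangle_\alpha$ be as below. There is a bijection between the set of $\mathrm{PO}(U)(k)$-orbits (under conjugation) on $V_f(k)$ and the set of classes $\alpha\in(L^\times/L^{\times2}k^\times)_{N=1}$ such that $\langle\,,\rangle_\alpha$ is split. Under this bijection the distinguished orbit corresponds to $\alpha=1$. Moreover, two $\mathrm{O}(U)(k)$-orbits corresponding (via the bijection between $\mathrm{O}(U)(k)$-orbits on $V_f(k)$ and classes $\alpha\in(L^\times/L^{\times2})_{N=1}$ with $\langle\,,\rangle_\alpha$ split) to $\alpha_1,\alpha_2\in(L^\times/L^{\times2})_{N=1}$ are $\mathrm{PO}(U)(k)$-equivalent if and only if $\alpha_1$ and $\alpha_2$ have the same image in $(L^\times/L^{\times2}k^\times)_{N=1}$.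
   Context: $k$ is a field of characteristic not $2$; $(U,Q)$ is the split quadratic space over $k$ of dimension $2n+2$ and discriminant $1$, with bilinear form $\langle v,w\rangle=Q(v+w)-Q(v)-Q(w)$; $f\in k[x]$ is monic of degree $2n+2$ with no repeated roots; $V_f(k)$ is the set of $k$-linear self-adjoint operators on $U$ with characteristic polynomial $f$; $\mathrm{O}(U)$ and $\mathrm{PO}(U)=\mathrm{O}(U)/\mu_2$ act by conjugation. $L=k[x]/f(x)$, $\beta$ the image of $x$; $(L^\times/L^{\times2})_{N=1}$ and $(L^\times/L^{\times2}k^\times)_{N=1}$ denote the elements whose norm to $k^\times/k^{\times2}$ is trivial. For $\alpha\in L^\times$, $\langle\lambda,\mu\rangle_\alpha=\mathrm{Tr}_{L/k}(\alpha\lambda\mu/f'(\beta))$; splitness depends only on the class of $\alpha$ in $L^\times/L^{\times2}k^\times$. The form $\langle\,,\rangle_1$ is split of discriminant $1$; choosing an isometry $\iota:(L,\langle\,,\rangle_1)\to(U,\langle\,,\rangle)$, put $T_f=\iota\circ(\cdot\beta)\circ\iota^{-1}$. The distinguished orbit is the $\mathrm{PO}(U)(k)$-orbit of $T_f$. *)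

theory Defs
  imports "Jordan_Normal_Form.Char_Poly" "HOL-Computational_Algebra.Polynomial"
begin

section \<open>Quadratic spaces: U = k^N with the polar bilinear form given by a Gram matrix B\<close>

definition mat_trace :: "'a::comm_ring_1 mat \<Rightarrow> 'a" where
  "mat_trace A = (\<Sum>i<dim_row A. A $$ (i,i))"

definition is_square :: "'a::comm_ring_1 \<Rightarrow> bool" where
  "is_square c \<longleftrightarrow> (\<exists>x. c = x ^ 2)"

text \<open>A symmetric bilinear form (Gram matrix G on k^N) is split: nondegenerate, N even,
  and there is a totally isotropic subspace of dimension N/2 (the column space of an
  injective N x (N/2) matrix M with M^T G M = 0).\<close>
definition split_form :: "'a::field mat \<Rightarrow> bool" where
  "split_form G \<longleftrightarrow>
     (let N = dim_row G in
       G \<in> carrier_mat N N \<and> transpose_mat G = G \<and> det G \<noteq> 0 \<and> even N \<and>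
       (\<exists>M \<in> carrier_mat N (N div 2).
          (\<forall>x \<in> carrier_vec (N div 2). M *\<^sub>v x = 0\<^sub>v N \<longrightarrow> x = 0\<^sub>v (N div 2)) \<and>
          transpose_mat M * G * M = 0\<^sub>m (N div 2) (N div 2)))"

definition disc_one :: "'a::field mat \<Rightarrow> bool" where
  "disc_one G \<longleftrightarrow> is_square ((-1) ^ (dim_row G div 2) * det G)"

definition self_adjoint :: "'a::field mat \<Rightarrow> 'a mat \<Rightarrow> bool" where
  "self_adjoint B T \<longleftrightarrow> transpose_mat T * B = B * T"

definition V_f :: "'a::field mat \<Rightarrow> 'a poly \<Rightarrow> 'a mat set" where
  "V_f B f = {T \<in> carrier_mat (dim_row B) (dim_row B). self_adjoint B T \<and> char_poly T = f}"

text \<open>k-points of PO(U) = O(U)/mu_2 = GO(U)/G_m are the orthogonal similitudes modulo scalars;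
  conjugation by them.\<close>
definition similitude :: "'a::field mat \<Rightarrow> 'a mat \<Rightarrow> bool" where
  "similitude B g \<longleftrightarrow> g \<in> carrier_mat (dim_row B) (dim_row B) \<and> invertible_mat g \<and>
     (\<exists>c. c \<noteq> 0 \<and> transpose_mat g * B * g = c \<cdot>\<^sub>m B)"

definition PO_conj :: "'a::field mat \<Rightarrow> ('a mat \<times> 'a mat) set" where
  "PO_conj B = {(T1, T2). \<exists>g. similitude B g \<and> T2 * g = g * T1}"

section \<open>The algebra L = k[x]/(f), elements represented by polynomials\<close>

definition L_mult_mat :: "'a::field poly \<Rightarrow> 'a poly \<Rightarrow> 'a mat" where
  "L_mult_mat f a = mat (degree f) (degree f) (\<lambda>(i,j). coeff ((a * monom 1 j) mod f) i)"

definition L_trace :: "'a::field poly \<Rightarrow> 'a poly \<Rightarrow> 'a" where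
  "L_trace f a = mat_trace (L_mult_mat f a)"

definition L_norm :: "'a::field poly \<Rightarrow> 'a poly \<Rightarrow> 'a" where
  "L_norm f a = det (L_mult_mat f a)"

definition L_unit :: "'a::field poly \<Rightarrow> 'a poly \<Rightarrow> bool" where
  "L_unit f a \<longleftrightarrow> (\<exists>b. (a * b) mod f = 1 mod f)"

definition L_inv :: "'a::field poly \<Rightarrow> 'a poly \<Rightarrow> 'a poly" where
  "L_inv f a = (SOME b. (a * b) mod f = 1 mod f)"

definition pairing_gram :: "'a::field poly \<Rightarrow> 'a poly \<Rightarrow> 'a mat" where
  "pairing_gram f \<alpha> = mat (degree f) (degree f)
     (\<lambda>(i,j). L_trace f (\<alpha> * monom 1 i * monom 1 j * L_inv f (pderiv f)))"

definition sq_class_rel :: "'a::field poly \<Rightarrow> ('a poly \<times> 'a poly) set" where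
  "sq_class_rel f = {(a, b). L_unit f a \<and> L_unit f b \<and>
      (\<exists>u. L_unit f u \<and> a mod f = (b * u * u) mod f)}"

definition ksq_class_rel :: "'a::field poly \<Rightarrow> ('a poly \<times> 'a poly) set" where
  "ksq_class_rel f = {(a, b). L_unit f a \<and> L_unit f b \<and>
      (\<exists>c u. c \<noteq> 0 \<and> L_unit f u \<and> a mod f = Polynomial.smult c (b * u * u) mod f)}"

definition norm_trivial :: "'a::field poly \<Rightarrow> 'a poly \<Rightarrow> bool" where
  "norm_trivial f a \<longleftrightarrow> is_square (L_norm f a)"

definition split_alphas :: "'a::field poly \<Rightarrow> 'a poly set" where
  "split_alphas f = {a. L_unit f a \<and> norm_trivial f a \<and> split_form (pairing_gram f a)}"

text \<open>T corresponds to alpha: there is a k-linear isomorphism P : L -> U with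
  P o (mult by beta) = T o P which is an isometry (L, <,>_alpha) -> (U, <,>).
  For alpha = 1 such T are exactly the conjugates T_f = iota (. beta) iota^{-1}.\<close>
definition corresponds :: "'a::field mat \<Rightarrow> 'a poly \<Rightarrow> 'a mat \<Rightarrow> 'a poly \<Rightarrow> bool" where
  "corresponds B f T a \<longleftrightarrow> T \<in> carrier_mat (dim_row B) (dim_row B) \<and>
     (\<exists>P \<in> carrier_mat (dim_row B) (degree f). invertible_mat P \<and>
        T * P = P * L_mult_mat f [:0, 1:] \<and>
        transpose_mat P * B * P = pairing_gram f a)"

end

theory Submission
  imports Defs
begin

text \<open>
  By Cayley--Hamilton and separability every \<open>T\<close> with characteristic polynomial \<open>f\<close> has a cyclic
  vector, so \<open>U\<close> with the action of \<open>T\<close> is \<open>L\<close> with multiplication by \<open>\<beta>\<close>. A symmetric form on \<open>L\<close>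
  for which \<open>\<beta>\<close> is self-adjoint is determined by a linear functional on \<open>L\<close>, and by Euler's dual basis
  every functional is \<open>\<lambda> \<mapsto> Tr (\<alpha> \<lambda> / f'(\<beta>))\<close> for a unique \<open>\<alpha>\<close>; so \<open>T\<close> comes from some
  \<open>\<langle>,\<rangle>\<^sub>\<alpha>\<close>. Conversely \<open>\<alpha>\<close> occurs exactly when \<open>\<langle>,\<rangle>\<^sub>\<alpha>\<close> is isometric to \<open>U\<close>, that is,
  split. A similitude intertwining two operators commutes with \<open>\<beta>\<close>, hence is multiplication by a unit \<open>u\<close>
  of \<open>L\<close>, and it changes \<open>\<alpha>\<close> by \<open>u\<^sup>2\<close> and the multiplier in \<open>k\<close>.
\<close>

section \<open>Invertible matrices\<close>

text \<open>Neither side of the correspondence determines the other: one \<open>T\<close> belongs to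
  a whole square class of \<alpha>, because the isometry from L may be changed by a unit, and one
  \<alpha> belongs to a whole orthogonal orbit. Hence \<open>corresponds\<close> is kept as a
  relation, and the bijection reduces to three facts: every T has an \<alpha>, every \<alpha> has a
  T, and PO-conjugacy matches equivalence modulo squares and scalars. The third fact is also the
  last claim of the theorem. Two devices keep the algebra elementary. Euler's formula turns Tr(g /
  f'(\<beta>)) into the top coefficient of g mod f, so that nondegeneracy and isotropy of the
  pairings become statements about coefficients. Witt's theory is replaced by a normal form: a split
  form is congruent to a hyperbolic matrix, hence split forms of equal dimension are isometric; the
  construction divides by 2. Since L need not be a field, everything is done with residues modulo f,
  and Bezout identities stand in for its decomposition into fields.\<close>

lemma invertible_matE:
  fixes A :: "'a::field mat"
  assumes "A \<in> carrier_mat n n" "invertible_mat A"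
  obtains A' where "A' \<in> carrier_mat n n" "A * A' = 1\<^sub>m n" "A' * A = 1\<^sub>m n"
proof -
  obtain A' where *: "A * A' = 1\<^sub>m n" "A' * A = 1\<^sub>m (dim_row A')"
    using assms by (auto simp: invertible_mat_def inverts_mat_def)
  have "dim_col A' = n" "dim_row A' = n"
    using arg_cong[OF *(1), of dim_col] arg_cong[OF *(2), of dim_col] assms by auto
  with * that[of A'] show thesis by auto
qed

lemma invertible_matI:
  fixes A :: "'a::field mat"
  assumes "A \<in> carrier_mat n n" "A' \<in> carrier_mat n n" "A * A' = 1\<^sub>m n"
  shows "invertible_mat A"
  using assms mat_mult_left_right_inverse[OF assms]
  by (auto simp: invertible_mat_def inverts_mat_def)

lemma invertible_mat_iff_det:
  fixes A :: "'a::field mat"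
  assumes A: "A \<in> carrier_mat n n"
  shows "invertible_mat A \<longleftrightarrow> det A \<noteq> 0"
proof
  assume "invertible_mat A"
  with A obtain A' where A': "A' \<in> carrier_mat n n" "A * A' = 1\<^sub>m n" by (rule invertible_matE)
  have "det A * det A' = 1" using det_mult[OF A A'(1)] A'(2) by simp
  then show "det A \<noteq> 0" by auto
next
  assume "det A \<noteq> 0"
  from det_non_zero_imp_unit[OF A this, of "()"]
  show "invertible_mat A"
    using A by (auto simp: Units_def ring_mat_def intro: invertible_matI)
qed

lemma invertible_mat_iff_kernel:
  fixes A :: "'a::field mat"
  assumes A: "A \<in> carrier_mat n n"
  shows "invertible_mat A \<longleftrightarrow> (\<forall>v \<in> carrier_vec n. A *\<^sub>v v = 0\<^sub>v n \<longrightarrow> v = 0\<^sub>v n)"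
  using det_0_iff_vec_prod_zero_field[OF A] invertible_mat_iff_det[OF A] by auto

text \<open>An injective matrix has a pivot in every column of its reduced echelon form, so the 0/1
  matrix that selects the pivot rows is a left inverse of that form. The lemma supplies vectors dual
  to a basis of an isotropic subspace.\<close>

lemma exists_left_inverse:
  fixes A :: "'a::field mat"
  assumes A: "A \<in> carrier_mat nr nc"
    and inj: "\<And>x. x \<in> carrier_vec nc \<Longrightarrow> A *\<^sub>v x = 0\<^sub>v nr \<Longrightarrow> x = 0\<^sub>v nc"
  shows "\<exists>X \<in> carrier_mat nc nr. X * A = 1\<^sub>m nc"
proof -
  define C where "C = gauss_jordan_single A"
  note gj = gauss_jordan_single[OF A C_def[symmetric]]
  note C = gj(2)
  obtain P where P: "P \<in> carrier_mat nr nr" and CPA: "C = P * A" using gj(4) by auto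
  obtain f where f: "pivot_fun C f nc" using gj(3) C by (auto simp: row_echelon_form_def)
  note piv = pivot_funD[OF carrier_matD(1)[OF C] f]
  \<comment> \<open>A column without pivot would produce a nonzero kernel vector of C, hence of
    A.\<close>
  have "snd ` set (pivot_positions C) = {0..<nc}"
    using find_base_vector[OF gj(3) C] gj(1) inj by blast
  then have "\<exists>i<nr. f i = j" if "j < nc" for j
    using that unfolding pivot_positions(1)[OF C f] by (auto simp: set_eq_iff image_iff) metis
  then obtain r where r: "\<And>j. j < nc \<Longrightarrow> r j < nr \<and> f (r j) = j" by metis
  define Y where "Y = mat nc nr (\<lambda>(j,i). if i = r j then 1 else 0 :: 'a)"
  have Y: "Y \<in> carrier_mat nc nr" by (simp add: Y_def)
  have "Y * C = 1\<^sub>m nc"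
  proof (rule eq_matI)
    fix j k assume "j < dim_row (1\<^sub>m nc)" "k < dim_col (1\<^sub>m nc)"
    then have jk: "j < nc" "k < nc" by auto
    have "(Y * C) $$ (j,k) = (\<Sum>i = 0..<nr. (if i = r j then 1 else 0) * C $$ (i,k))"
      using jk C by (auto simp: Y_def scalar_prod_def intro!: sum.cong)
    also have "\<dots> = (\<Sum>i = 0..<nr. if i = r j then C $$ (i,k) else 0)"
      by (intro sum.cong) auto
    also have "\<dots> = C $$ (r j, k)" using r[OF jk(1)] by simp
    also have "\<dots> = 1\<^sub>m nc $$ (j,k)"
      using piv(4)[of "r k"] piv(5)[of "r k" "r j"] r jk by (cases "j = k") (auto, metis)
    finally show "(Y * C) $$ (j,k) = 1\<^sub>m nc $$ (j,k)" .
  qed (use Y C in auto)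
  then have "(Y * P) * A = 1\<^sub>m nc" using Y P A CPA by simp
  with Y P show ?thesis by (intro bexI[of _ "Y * P"]) auto
qed

lemma mult_mat_vec_unit:
  fixes A :: "'a::field mat"
  assumes "A \<in> carrier_mat nr nc" "j < nc"
  shows "A *\<^sub>v unit_vec nc j = col A j"
  using assms by (intro eq_vecI) auto

lemma smult_mat_mult_vec:
  fixes A :: "'a::field mat"
  assumes "A \<in> carrier_mat nr nc" "v \<in> carrier_vec nc"
  shows "(c \<cdot>\<^sub>m A) *\<^sub>v v = c \<cdot>\<^sub>v (A *\<^sub>v v)"
  using assms by (intro eq_vecI) (auto simp: scalar_prod_def sum_distrib_left mult.assoc)

lemma mult_mat_reassoc:
  fixes X :: "'a::field mat"
  assumes "X * Y = Z" "X \<in> carrier_mat N N" "Y \<in> carrier_mat N N" "W \<in> carrier_mat N N"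
  shows "X * (Y * W) = Z * W"
  using assms by (metis assoc_mult_mat)

lemma congruence_mult:
  fixes X :: "'a::field mat"
  assumes "X \<in> carrier_mat N N" "Y \<in> carrier_mat N N" "G \<in> carrier_mat N N"
  shows "transpose_mat (X * Y) * G * (X * Y) = transpose_mat Y * (transpose_mat X * G * X) * Y"
  using assms
  by (simp add: transpose_mult[of _ N N _ N] assoc_mult_mat[of _ N N _ N _ N])

lemma congruence_cancel:
  fixes P :: "'a::field mat"
  assumes P: "P \<in> carrier_mat N N" "invertible_mat P"
    and XY: "X \<in> carrier_mat N N" "Y \<in> carrier_mat N N"
    and eq: "transpose_mat P * X * P = transpose_mat P * Y * P"
  shows "X = Y"
proof -
  obtain P' where P': "P' \<in> carrier_mat N N" "P * P' = 1\<^sub>m N" using invertible_matE[OF P] by metis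
  have "transpose_mat P' * (transpose_mat P * Z * P) * P' = Z" if "Z \<in> carrier_mat N N" for Z
    using congruence_mult[OF P(1) P'(1) that] P' that by simp
  then show ?thesis using XY eq by metis
qed

lemma invertible_mat_mult:
  fixes X :: "'a::field mat"
  assumes "X \<in> carrier_mat N N" "Y \<in> carrier_mat N N" "invertible_mat X" "invertible_mat Y"
  shows "invertible_mat (X * Y)"
  using assms by (simp add: invertible_mat_iff_det[of _ N] det_mult[of _ N])

lemma det_congruence:
  fixes P :: "'a::field mat"
  assumes "P \<in> carrier_mat N N" "G \<in> carrier_mat N N"
  shows "det (transpose_mat P * G * P) = det P ^ 2 * det G"
  using assms by (simp add: det_mult[of _ N] det_transpose[of _ N] power2_eq_square)

section \<open>Split forms\<close>

definition hyperbolic_mat :: "nat \<Rightarrow> 'a::field mat" where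
  "hyperbolic_mat m = four_block_mat (0\<^sub>m m m) (1\<^sub>m m) (1\<^sub>m m) (0\<^sub>m m m)"

lemma hyperbolic_mat_carrier [simp]: "hyperbolic_mat m \<in> carrier_mat (2*m) (2*m)"
  by (auto simp: hyperbolic_mat_def)

lemma hyperbolic_mat_square: "hyperbolic_mat m * hyperbolic_mat m = (1\<^sub>m (2*m) :: 'a::field mat)"
proof -
  have "hyperbolic_mat m * hyperbolic_mat m
      = (four_block_mat (1\<^sub>m m) (0\<^sub>m m m) (0\<^sub>m m m) (1\<^sub>m m) :: 'a mat)"
    unfolding hyperbolic_mat_def by (subst mult_four_block_mat[of _ m m _ m _ m]) auto
  also have "\<dots> = 1\<^sub>m (2*m)" by (rule eq_matI) auto
  finally show ?thesis .
qed

text \<open>Nondegeneracy provides vectors K dual to the isotropic columns of M. A correction inside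
  the span of M makes them isotropic too, and M together with the corrected vectors is a hyperbolic
  basis.\<close>

lemma split_form_congruent_hyperbolic:
  fixes G :: "'a::field mat"
  assumes two: "(2::'a) \<noteq> 0" and G: "G \<in> carrier_mat (2*m) (2*m)" and split: "split_form G"
  shows "\<exists>S \<in> carrier_mat (2*m) (2*m). invertible_mat S \<and> transpose_mat S * G * S = hyperbolic_mat m"
proof -
  have N: "dim_row G = 2*m" using G by simp
  have symG: "transpose_mat G = G" and detG: "det G \<noteq> 0"
    using split by (auto simp: split_form_def Let_def)
  obtain M where M: "M \<in> carrier_mat (2*m) m"
    and injM: "\<And>x. x \<in> carrier_vec m \<Longrightarrow> M *\<^sub>v x = 0\<^sub>v (2*m) \<Longrightarrow> x = 0\<^sub>v m"
    and isoM: "transpose_mat M * G * M = 0\<^sub>m m m"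
    using split unfolding split_form_def Let_def N by auto
  obtain X where X: "X \<in> carrier_mat m (2*m)" "X * M = 1\<^sub>m m"
    using exists_left_inverse[OF M injM] by auto
  obtain G' where G': "G' \<in> carrier_mat (2*m) (2*m)" "G * G' = 1\<^sub>m (2*m)"
    using invertible_matE[OF G] detG invertible_mat_iff_det[OF G] by metis
  \<comment> \<open>Solves \<open>G * K = transpose_mat X\<close>, so the pairing of M with K is the
    transpose of \<open>X * M\<close>, the identity.\<close>
  define K where "K = G' * transpose_mat X"
  have K: "K \<in> carrier_mat (2*m) m" using G' X by (simp add: K_def)
  have GK: "G * K = transpose_mat X"
    unfolding K_def using assoc_mult_mat[OF G G'(1), of "transpose_mat X" m] X G' by simp
  have MGK: "transpose_mat M * (G * K) = 1\<^sub>m m"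
    unfolding GK using transpose_mult[OF X(1) M] X by simp
  define D where "D = transpose_mat K * (G * K)"
  have D: "D \<in> carrier_mat m m" using G K by (simp add: D_def)
  have symD: "transpose_mat D = D"
  proof -
    have "transpose_mat D = transpose_mat (G * K) * K"
      unfolding D_def using transpose_mult[of "transpose_mat K" m "2*m" "G*K" m] K G by simp
    also have "\<dots> = transpose_mat K * G * K"
      using transpose_mult[OF G K] symG by simp
    finally show ?thesis using K G by (simp add: D_def)
  qed
  \<comment> \<open>For symmetric E the vectors \<open>K + M * E\<close> have Gram matrix
    \<open>D + E + E\<close>. Making it vanish forces this E, and is the place where 2 must be
    invertible.\<close>
  define E where "E = (- 1/2) \<cdot>\<^sub>m D"
  have E: "E \<in> carrier_mat m m" using D by (simp add: E_def)
  have symE: "transpose_mat E = E"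
  proof -
    have "transpose_mat E = (- 1/2) \<cdot>\<^sub>m transpose_mat D"
      unfolding E_def by (intro eq_matI) auto
    then show ?thesis by (simp add: symD E_def)
  qed
  have DEE: "D + E + E = 0\<^sub>m m m"
  proof -
    have "x - x/2 - x/2 = (0::'a)" for x
    proof -
      have "x = x/2 + x/2" using two by (simp add: field_simps)
      then show ?thesis by (simp add: algebra_simps)
    qed
    then show ?thesis using D by (intro eq_matI) (auto simp: E_def)
  qed
  \<comment> \<open>The columns of \<open>K\<close> are dual to those of \<open>M\<close>; adding \<open>M E\<close> makes them isotropic without
    disturbing the duality.\<close>
  define K' where "K' = K + M * E"
  have ME: "M * E \<in> carrier_mat (2*m) m" using M E by simp
  have K': "K' \<in> carrier_mat (2*m) m" using K ME by (simp add: K'_def)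
  have Mt: "transpose_mat M \<in> carrier_mat m (2*m)" and Kt: "transpose_mat K \<in> carrier_mat m (2*m)"
    and Et: "transpose_mat E \<in> carrier_mat m m"
    using M K E by auto
  have GM: "G * M \<in> carrier_mat (2*m) m" and GKc: "G * K \<in> carrier_mat (2*m) m"
    using G M K by auto
  have KGM: "transpose_mat K * (G * M) = 1\<^sub>m m"
  proof -
    have "transpose_mat K * (G * M) = transpose_mat (G * K) * M"
      using transpose_mult[OF G K] symG Kt G M by simp
    also have "\<dots> = transpose_mat (transpose_mat M * (G * K))"
      using transpose_mult[OF Mt GKc] by simp
    finally show ?thesis using MGK by simp
  qed
  have MGM: "transpose_mat M * (G * M) = 0\<^sub>m m m"
    using isoM Mt G M by simp
  have GK': "G * K' = G * K + (G * M) * E"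
    unfolding K'_def using G K ME M E by (simp add: mult_add_distrib_mat[OF G K ME])
  have GME: "G * M * E \<in> carrier_mat (2*m) m" using GM E by auto
  have MGK': "transpose_mat M * (G * K') = 1\<^sub>m m"
  proof -
    have "transpose_mat M * (G * M * E) = 0\<^sub>m m m"
      using assoc_mult_mat[OF Mt GM E] MGM E by simp
    then show ?thesis
      unfolding GK' using mult_add_distrib_mat[OF Mt GKc GME] MGK by simp
  qed
  have KGK': "transpose_mat K * (G * K') = D + E"
    unfolding GK' using mult_add_distrib_mat[OF Kt GKc GME] assoc_mult_mat[OF Kt GM E] KGM E
    by (simp add: D_def)
  have GK'c: "G * K' \<in> carrier_mat (2*m) m" using G K' by auto
  have K'GK': "transpose_mat K' * (G * K') = 0\<^sub>m m m"
  proof -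
    have "transpose_mat K' = transpose_mat K + E * transpose_mat M"
      unfolding K'_def using transpose_add[OF K ME] transpose_mult[OF M E] symE by simp
    then have "transpose_mat K' * (G * K') = D + E + E * transpose_mat M * (G * K')"
      using add_mult_distrib_mat[OF Kt _ GK'c, of "E * transpose_mat M"] E Mt KGK' by simp
    also have "E * transpose_mat M * (G * K') = E"
      using assoc_mult_mat[OF E Mt GK'c] MGK' E by simp
    finally show ?thesis using DEE by simp
  qed
  have K't: "transpose_mat K' \<in> carrier_mat m (2*m)" using K' by auto
  have K'GM: "transpose_mat K' * (G * M) = 1\<^sub>m m"
  proof -
    have "transpose_mat K' * (G * M) = transpose_mat (G * K') * M"
      using transpose_mult[OF G K'] symG K't G M by simp
    also have "\<dots> = transpose_mat (transpose_mat M * (G * K'))"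
      using transpose_mult[OF Mt GK'c] by simp
    finally show ?thesis using MGK' by simp
  qed
  \<comment> \<open>M and K' side by side, encoded with lower blocks of zero rows. Below, G is
    padded with empty blocks in the same way so that block multiplication applies.\<close>
  define S where "S = four_block_mat M K' (0\<^sub>m 0 m) (0\<^sub>m 0 m)"
  have S: "S \<in> carrier_mat (2*m) (2*m)"
    using four_block_carrier_mat[OF M, of "0\<^sub>m 0 m" 0 m K' "0\<^sub>m 0 m"] by (simp add: S_def mult_2)
  have St: "transpose_mat S = four_block_mat (transpose_mat M) (0\<^sub>m m 0) (transpose_mat K') (0\<^sub>m m 0)"
    unfolding S_def by (subst transpose_four_block_mat[OF M K' zero_carrier_mat zero_carrier_mat]) simp
  have GS: "G * S = four_block_mat (G * M) (G * K') (0\<^sub>m 0 m) (0\<^sub>m 0 m)"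
  proof -
    have G4: "G = four_block_mat G (0\<^sub>m (2*m) 0) (0\<^sub>m 0 (2*m)) (0\<^sub>m 0 0)"
      using G by (intro eq_matI) auto
    have "G * S = four_block_mat G (0\<^sub>m (2*m) 0) (0\<^sub>m 0 (2*m)) (0\<^sub>m 0 0) * S"
      using G4 by simp
    also have "\<dots> = four_block_mat (G * M + 0\<^sub>m (2*m) 0 * 0\<^sub>m 0 m) (G * K' + 0\<^sub>m (2*m) 0 * 0\<^sub>m 0 m)
        (0\<^sub>m 0 (2*m) * M + 0\<^sub>m 0 0 * 0\<^sub>m 0 m) (0\<^sub>m 0 (2*m) * K' + 0\<^sub>m 0 0 * 0\<^sub>m 0 m)"
      unfolding S_def using G M K' by (subst mult_four_block_mat[of _ "2*m" "2*m" _ 0 _ 0 _ _ m _ m]) auto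
    also have "\<dots> = four_block_mat (G * M) (G * K') (0\<^sub>m 0 m) (0\<^sub>m 0 m)"
      using GM GK'c M K' by simp
    finally show ?thesis .
  qed
  have "transpose_mat S * (G * S) = hyperbolic_mat m"
    unfolding St GS hyperbolic_mat_def
    using Mt K't GM GK'c MGM MGK' K'GM K'GK'
    by (subst mult_four_block_mat[of _ m "2*m" _ 0 _ m _ _ m _ m]) auto
  then have SGS: "transpose_mat S * G * S = hyperbolic_mat m" using S G by simp
  \<comment> \<open>Independence of the columns of S is not checked directly: the hyperbolic matrix
    squares to 1, and its nonzero determinant has \<open>det S\<close> as a factor.\<close>
  have "det (hyperbolic_mat m :: 'a mat) * det (hyperbolic_mat m) = 1"
    using det_mult[of "hyperbolic_mat m :: 'a mat" "2*m" "hyperbolic_mat m"]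
    by (simp add: hyperbolic_mat_square)
  moreover have "det (transpose_mat S * G * S) = det (transpose_mat S * G) * det S"
    using det_mult[of "transpose_mat S * G" "2*m" S] S G by auto
  ultimately have "det S \<noteq> 0" using SGS by auto
  then show ?thesis using S SGS invertible_mat_iff_det[OF S] by blast
qed

text \<open>The isotropic subspace is carried along by the inverse of P.\<close>

lemma split_form_congruence:
  fixes G :: "'a::field mat"
  assumes G: "G \<in> carrier_mat N N" "split_form G" and P: "P \<in> carrier_mat N N" "invertible_mat P"
  shows "split_form (transpose_mat P * G * P)"
proof -
  define m where "m = N div 2"
  have sym: "transpose_mat G = G" and det: "det G \<noteq> 0" and even: "even N"
    using G by (auto simp: split_form_def Let_def)
  obtain M where M: "M \<in> carrier_mat N m"
    and inj: "\<And>x. x \<in> carrier_vec m \<Longrightarrow> M *\<^sub>v x = 0\<^sub>v N \<Longrightarrow> x = 0\<^sub>v m"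
    and iso: "transpose_mat M * G * M = 0\<^sub>m m m"
    using G by (auto simp: split_form_def Let_def m_def)
  obtain P' where P': "P' \<in> carrier_mat N N" "P * P' = 1\<^sub>m N" using invertible_matE[OF P] by metis
  let ?G = "transpose_mat P * G * P"
  have Gc: "?G \<in> carrier_mat N N" using P G by simp
  have PM: "P' * M \<in> carrier_mat N m" using P' M by simp
  have PPM: "P * (P' * M) = M" using assoc_mult_mat[OF P(1) P'(1) M] P' M by simp
  have "x = 0\<^sub>v m" if x: "x \<in> carrier_vec m" "(P' * M) *\<^sub>v x = 0\<^sub>v N" for x
  proof (rule inj[OF x(1)])
    have "M *\<^sub>v x = P *\<^sub>v ((P' * M) *\<^sub>v x)" using assoc_mult_mat_vec[OF P(1) PM x(1)] PPM by simp
    then show "M *\<^sub>v x = 0\<^sub>v N" using x P by (auto intro: eq_vecI)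
  qed
  moreover have "transpose_mat (P' * M) * ?G * (P' * M) = 0\<^sub>m m m"
  proof -
    have 1: "transpose_mat (P' * M) * transpose_mat P = transpose_mat M"
      using transpose_mult[OF P(1) PM] by (simp add: PPM)
    have "transpose_mat (P' * M) * ?G * (P' * M) = transpose_mat (P' * M) * transpose_mat P * (G * (P * (P' * M)))"
      using P G PM by (simp add: assoc_mult_mat[of _ N N _ N _ N] assoc_mult_mat[of _ N N _ N _ m] assoc_mult_mat[of _ m N _ N _ m]
        assoc_mult_mat[of _ m N _ N _ N])
    also have "\<dots> = transpose_mat M * G * M" unfolding 1 PPM using M G by simp
    finally show ?thesis using iso by simp
  qed
  moreover have "transpose_mat ?G = ?G"
    using P G by (simp add: transpose_mult[of _ N N _ N] sym assoc_mult_mat[of _ N N _ N _ N])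
  moreover have "det ?G \<noteq> 0"
    unfolding det_congruence[OF P(1) G(1)] using det P by (simp add: invertible_mat_iff_det)
  ultimately show ?thesis
    using PM Gc even carrier_matD[OF Gc] unfolding split_form_def Let_def m_def by auto
qed

text \<open>Uniqueness of the split space of given dimension. It yields both the isometry from L to
  U for a split \<alpha> and the comparison of a pairing with the one for \<alpha> = 1.\<close>

lemma split_form_congruent:
  fixes G G' :: "'a::field mat"
  assumes two: "(2::'a) \<noteq> 0"
    and G: "G \<in> carrier_mat N N" "split_form G" and G': "G' \<in> carrier_mat N N" "split_form G'"
  shows "\<exists>P \<in> carrier_mat N N. invertible_mat P \<and> transpose_mat P * G * P = G'"
proof -
  have "even N" using G by (auto simp: split_form_def Let_def)
  then obtain m where N: "N = 2 * m" by auto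
  obtain S where S: "S \<in> carrier_mat N N" "invertible_mat S" "transpose_mat S * G * S = hyperbolic_mat m"
    using split_form_congruent_hyperbolic[OF two] G unfolding N by blast
  obtain S' where S': "S' \<in> carrier_mat N N" "invertible_mat S'" "transpose_mat S' * G' * S' = hyperbolic_mat m"
    using split_form_congruent_hyperbolic[OF two] G' unfolding N by blast
  obtain R where R: "R \<in> carrier_mat N N" "S' * R = 1\<^sub>m N" "R * S' = 1\<^sub>m N"
    using invertible_matE[OF S'(1,2)] by metis
  have "transpose_mat (S * R) * G * (S * R) = transpose_mat (S' * R) * G' * (S' * R)"
    unfolding congruence_mult[OF S(1) R(1) G(1)] congruence_mult[OF S'(1) R(1) G'(1)] S(3) S'(3) ..
  also have "\<dots> = G'" using R G' by simp
  finally show ?thesis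
    using S R invertible_matI[OF R(1) S'(1) R(3)] invertible_mat_mult[OF S(1) R(1)]
    by (intro bexI[of _ "S * R"]) auto
qed

section \<open>Coprimality of polynomials\<close>

lemma poly_bezout:
  fixes a b :: "'a::field poly"
  shows "\<exists>d u v. d dvd a \<and> d dvd b \<and> u * a + v * b = d"
\<comment> \<open>Euclid's algorithm. The measure must separate the zero polynomial from nonzero
  constants, which share degree 0.\<close>
proof (induction "if b = 0 then 0 else Suc (degree b)" arbitrary: a b rule: less_induct)
  case less
  show ?case
  proof (cases "b = 0")
    case True
    then have "a dvd a \<and> a dvd b \<and> 1 * a + 0 * b = a" by simp
    then show ?thesis by blast
  next
    case False
    have "(if a mod b = 0 then 0 else Suc (degree (a mod b))) < (if b = 0 then 0 else Suc (degree b))"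
      using False degree_mod_less[of b a] by auto
    from less[OF this] obtain d u v where d: "d dvd b" "d dvd a mod b" "u * b + v * (a mod b) = d"
      by blast
    have "d dvd a" using d by (simp add: dvd_mod_iff)
    moreover have "v * a + (u - v * (a div b)) * b = d"
    proof -
      have "u * b + v * (a - a div b * b) = d" using d(3) by (simp only: minus_div_mult_eq_mod)
      then show ?thesis by (simp only: algebra_simps)
    qed
    ultimately show ?thesis using d(1) by blast
  qed
qed

lemma poly_coprime_bezout:
  fixes a b :: "'a::field poly"
  assumes "coprime a b"
  shows "\<exists>u v. u * a + v * b = 1"
proof -
  obtain d u v where d: "d dvd a" "d dvd b" "u * a + v * b = d" using poly_bezout by blast
  then have "d dvd 1" using assms by (meson coprime_common_divisor)
  then obtain e where "1 = d * e" unfolding dvd_def by blast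
  then have "e * (u * a + v * b) = 1" using d(3) by (simp add: mult.commute)
  then have "(e * u) * a + (e * v) * b = 1" by (simp only: distrib_left mult.assoc)
  then show ?thesis by blast
qed

text \<open>A divisor of least positive degree is irreducible: its Bezout divisor with h is either
  constant or associated to it. Primality is recorded as this Bezout alternative, the form in which
  it is applied below.\<close>

lemma poly_prime_divisor:
  fixes g :: "'a::field poly"
  assumes "degree g > 0"
  shows "\<exists>p. p dvd g \<and> degree p > 0 \<and> (\<forall>h. p dvd h \<or> (\<exists>u v. u * p + v * h = 1))"
proof -
  obtain p where p: "p dvd g" "degree p > 0"
    and min: "\<And>q. q dvd g \<Longrightarrow> degree q > 0 \<Longrightarrow> degree p \<le> degree q"
    using assms ex_has_least_nat[of "\<lambda>q. q dvd g \<and> degree q > 0" g degree] by auto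
  have "p dvd h \<or> (\<exists>u v. u * p + v * h = 1)" for h
  proof -
    obtain d u v where d: "d dvd p" "d dvd h" "u * p + v * h = d" using poly_bezout by blast
    have "p \<noteq> 0" using p by auto
    then have "d \<noteq> 0" using d by auto
    show ?thesis
    proof (cases "degree d = 0")
      case True
      then obtain c where c: "d = [:c:]" "c \<noteq> 0" using \<open>d \<noteq> 0\<close> by (metis degree_eq_zeroE pCons_0_0)
      then have "[:inverse c:] * (u * p + v * h) = 1" using d(3) by (simp add: one_pCons)
      then have "([:inverse c:] * u) * p + ([:inverse c:] * v) * h = 1"
        by (simp only: distrib_left mult.assoc)
      then show ?thesis by blast
    next
      case False
      then have "degree p \<le> degree d" using min d(1) p(1) dvd_trans by blast
      moreover obtain e where e: "p = d * e" using d(1) unfolding dvd_def by blast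
      ultimately have "degree e = 0" using \<open>p \<noteq> 0\<close> by (auto simp: degree_mult_eq)
      then obtain c where c: "e = [:c:]" "c \<noteq> 0" using e \<open>p \<noteq> 0\<close> by (metis degree_eq_zeroE mult_zero_right pCons_0_0)
      have "p * [:inverse c:] = d" using e c by simp
      then have "p dvd d" by (metis dvd_triv_left)
      then show ?thesis using d(2) dvd_trans by blast
    qed
  qed
  then show ?thesis using p by blast
qed

lemma poly_prime_dvd_mult:
  fixes p :: "'a::field poly"
  assumes "\<forall>h. p dvd h \<or> (\<exists>u v. u * p + v * h = 1)" and "p dvd a * b"
  shows "p dvd a \<or> p dvd b"
proof (rule disjCI)
  assume "\<not> p dvd b"
  then obtain u v where uv: "u * p + v * b = 1" using assms(1) by blast
  have "p dvd (a * u) * p + v * (a * b)" by (rule dvd_add[OF dvd_triv_right dvd_mult[OF assms(2)]])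
  also have "(a * u) * p + v * (a * b) = a * (u * p + v * b)" by (simp add: algebra_simps)
  finally show "p dvd a" using uv by simp
qed

lemma poly_prime_dvd_power:
  fixes p :: "'a::field poly"
  assumes "\<forall>h. p dvd h \<or> (\<exists>u v. u * p + v * h = 1)" and "degree p > 0" and "p dvd a ^ k"
  shows "p dvd a"
  using assms(3)
proof (induction k)
  case 0
  then have "is_unit p" by simp
  then show ?case using assms(2) by (auto simp: is_unit_iff_degree)
next
  case (Suc k)
  then show ?case using poly_prime_dvd_mult[OF assms(1), of a "a ^ k"] by auto
qed

section \<open>Polynomials in a matrix\<close>

definition poly_mat :: "'a::field poly \<Rightarrow> 'a mat \<Rightarrow> 'a mat" where
  "poly_mat h T = fold_coeffs (\<lambda>c M. c \<cdot>\<^sub>m 1\<^sub>m (dim_row T) + T * M) h (0\<^sub>m (dim_row T) (dim_row T))"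

context
  fixes T :: "'a::field mat" and N :: nat
  assumes T: "T \<in> carrier_mat N N"
begin

lemma poly_mat_0: "poly_mat 0 T = 0\<^sub>m N N"
  using T by (simp add: poly_mat_def)

lemma poly_mat_pCons: "poly_mat (pCons c h) T = c \<cdot>\<^sub>m 1\<^sub>m N + T * poly_mat h T"
proof (cases "c = 0 \<and> h = 0")
  case True
  then show ?thesis using T by (auto simp: poly_mat_def)
next
  case False
  then show ?thesis using T by (auto simp: poly_mat_def)
qed

lemma poly_mat_carrier [simp]: "poly_mat h T \<in> carrier_mat N N"
  by (induction h) (use T in \<open>auto simp: poly_mat_0 poly_mat_pCons\<close>)

lemma poly_mat_const: "poly_mat [:c:] T = c \<cdot>\<^sub>m 1\<^sub>m N"
  using T by (simp add: poly_mat_0 poly_mat_pCons)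

lemma poly_mat_1: "poly_mat 1 T = 1\<^sub>m N"
  unfolding one_pCons poly_mat_const by (intro eq_matI) auto

lemma poly_mat_X: "poly_mat [:0,1:] T = T"
  using T by (simp add: poly_mat_pCons poly_mat_0) (intro eq_matI, auto)

lemma poly_mat_add: "poly_mat (g + h) T = poly_mat g T + poly_mat h T"
proof (induction g h rule: poly_induct2)
  case 0
  then show ?case by (simp add: poly_mat_0)
next
  case (pCons a p b q)
  have "poly_mat (pCons a p + pCons b q) T
      = (a + b) \<cdot>\<^sub>m 1\<^sub>m N + (T * poly_mat p T + T * poly_mat q T)"
    using T by (simp add: poly_mat_pCons pCons mult_add_distrib_mat[of T N N _ N])
  also have "\<dots> = poly_mat (pCons a p) T + poly_mat (pCons b q) T"
    unfolding poly_mat_pCons using T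
    by (intro eq_matI) (auto simp: algebra_simps carrier_matD[OF poly_mat_carrier])
  finally show ?case .
qed

lemma poly_mat_smult: "poly_mat (Polynomial.smult c h) T = c \<cdot>\<^sub>m poly_mat h T"
proof (induction h)
  case 0
  then show ?case by (simp add: poly_mat_0)
next
  case (pCons a p)
  have "poly_mat (Polynomial.smult c (pCons a p)) T = (c * a) \<cdot>\<^sub>m 1\<^sub>m N + c \<cdot>\<^sub>m (T * poly_mat p T)"
    using T by (simp add: poly_mat_pCons pCons mult_smult_distrib[of T N N _ N])
  also have "\<dots> = c \<cdot>\<^sub>m poly_mat (pCons a p) T"
    unfolding poly_mat_pCons using T
    by (intro eq_matI) (auto simp: algebra_simps carrier_matD[OF poly_mat_carrier])
  finally show ?case .
qed

lemma poly_mat_mult: "poly_mat (g * h) T = poly_mat g T * poly_mat h T"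
proof (induction g)
  case 0
  then show ?case by (simp add: poly_mat_0 left_mult_zero_mat[of _ N N])
next
  case (pCons a p)
  have "poly_mat (pCons a p * h) T = a \<cdot>\<^sub>m poly_mat h T + T * (poly_mat p T * poly_mat h T)"
    using T by (simp add: poly_mat_add poly_mat_smult poly_mat_pCons pCons.IH)
      (intro eq_matI, auto simp: carrier_matD[OF poly_mat_carrier])
  also have "\<dots> = (a \<cdot>\<^sub>m 1\<^sub>m N) * poly_mat h T + T * poly_mat p T * poly_mat h T"
    using T by (simp add: assoc_mult_mat[of _ N N _ N _ N] mult_smult_assoc_mat[of _ N N _ N]
      left_mult_one_mat[of _ N N])
  also have "\<dots> = poly_mat (pCons a p) T * poly_mat h T"
    unfolding poly_mat_pCons using T by (subst add_mult_distrib_mat[of _ N N _ _ N]) auto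
  finally show ?case .
qed

lemma poly_mat_mult_vec:
  assumes "v \<in> carrier_vec N"
  shows "poly_mat (g * h) T *\<^sub>v v = poly_mat g T *\<^sub>v (poly_mat h T *\<^sub>v v)"
  using assms by (simp add: poly_mat_mult assoc_mult_mat_vec[of _ N N _ N])

lemma poly_mat_add_vec:
  assumes "v \<in> carrier_vec N"
  shows "poly_mat (g + h) T *\<^sub>v v = poly_mat g T *\<^sub>v v + poly_mat h T *\<^sub>v v"
  using assms by (simp add: poly_mat_add add_mult_distrib_mat_vec[of _ N N])

section \<open>Divisibility by x I - T, and Cayley-Hamilton\<close>

lemma char_poly_matrix_mult_index:
  assumes R: "R \<in> carrier_mat N N" and ij: "i < N" "j < N"
  shows "(char_poly_matrix T * R) $$ (i,j) = pCons 0 (R $$ (i,j)) - (\<Sum>k<N. Polynomial.smult (T $$ (i,k)) (R $$ (k,j)))"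
proof -
  have "(char_poly_matrix T * R) $$ (i,j) = (\<Sum>k = 0..<N. char_poly_matrix T $$ (i,k) * R $$ (k,j))"
    using R T ij by (auto simp: scalar_prod_def char_poly_matrix_def intro!: sum.cong)
  also have "\<dots> = (\<Sum>k = 0..<N. (if k = i then pCons 0 (R $$ (i,j)) else 0)
      - Polynomial.smult (T $$ (i,k)) (R $$ (k,j)))"
    using T ij by (intro sum.cong) (auto simp: char_poly_matrix_def algebra_simps)
  also have "\<dots> = pCons 0 (R $$ (i,j)) - (\<Sum>k<N. Polynomial.smult (T $$ (i,k)) (R $$ (k,j)))"
    using ij by (simp add: sum_subtractf atLeast0LessThan)
  finally show ?thesis .
qed

text \<open>The factor theorem for a matrix argument. In the Horner step, c + x h - (c + T h(T))
  equals (x - T) h(T) + x (h - h(T)), so the quotient grows to h(T) + x Q.\<close>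

lemma char_poly_matrix_dvd:
  "\<exists>Q \<in> carrier_mat N N. h \<cdot>\<^sub>m 1\<^sub>m N - map_mat (\<lambda>c. [:c:]) (poly_mat h T) = char_poly_matrix T * Q"
proof (induction h)
  case 0
  have "char_poly_matrix T * 0\<^sub>m N N = 0\<^sub>m N N"
    using char_poly_matrix_closed[OF T] by simp
  then show ?case by (intro bexI[of _ "0\<^sub>m N N"]) (auto simp: poly_mat_0)
next
  case (pCons c h)
  let ?C = "map_mat (\<lambda>c. [:c:]) :: 'a mat \<Rightarrow> 'a poly mat"
  let ?h = "poly_mat h T"
  obtain Q where Q: "Q \<in> carrier_mat N N"
    and IH: "h \<cdot>\<^sub>m 1\<^sub>m N - ?C ?h = char_poly_matrix T * Q" using pCons.IH by blast
  have X: "char_poly_matrix T \<in> carrier_mat N N" using T by simp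
  have CT: "?C T \<in> carrier_mat N N" using T by simp
  define Q' where "Q' = ?C ?h + [:0,1:] \<cdot>\<^sub>m Q"
  have Q': "Q' \<in> carrier_mat N N" using Q by (simp add: Q'_def)
  have "pCons c h \<cdot>\<^sub>m 1\<^sub>m N - ?C (poly_mat (pCons c h) T) = char_poly_matrix T * Q'"
  proof (rule eq_matI)
    fix i j assume "i < dim_row (char_poly_matrix T * Q')" "j < dim_col (char_poly_matrix T * Q')"
    then have ij: "i < N" "j < N" using X Q' by auto
    have IHij: "(char_poly_matrix T * Q) $$ (i,j) = h * (if i = j then 1 else 0) - [:?h $$ (i,j):]"
      using ij arg_cong[OF IH, of "\<lambda>M. M $$ (i,j)"] by (auto simp: carrier_matD[OF poly_mat_carrier])
    have "(char_poly_matrix T * Q') $$ (i,j)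
      = pCons 0 ([:?h $$ (i,j):] + [:0,1:] * Q $$ (i,j))
        - (\<Sum>k<N. Polynomial.smult (T $$ (i,k)) ([:?h $$ (k,j):] + [:0,1:] * Q $$ (k,j)))"
      using ij Q unfolding char_poly_matrix_mult_index[OF Q' ij]
      by (intro arg_cong2[where f="(-)"] arg_cong[where f="pCons 0"] sum.cong
          arg_cong[where f="Polynomial.smult _"])
        (auto simp: Q'_def carrier_matD[OF poly_mat_carrier])
    also have "\<dots> = pCons 0 [:?h $$ (i,j):] - (\<Sum>k<N. [:T $$ (i,k) * ?h $$ (k,j):])
        + [:0,1:] * (char_poly_matrix T * Q) $$ (i,j)"
      unfolding char_poly_matrix_mult_index[OF Q ij]
      by (simp add: smult_add_right sum.distrib algebra_simps sum_distrib_left) (simp flip: sum.distrib)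
    also have "(\<Sum>k<N. [:T $$ (i,k) * ?h $$ (k,j):]) = [:(T * ?h) $$ (i,j):]"
      using ij T by (auto simp: poly_eq_iff coeff_sum scalar_prod_def coeff_pCons atLeast0LessThan carrier_matD[OF poly_mat_carrier]
        split: nat.splits intro!: sum.cong)
    finally show "(pCons c h \<cdot>\<^sub>m 1\<^sub>m N - ?C (poly_mat (pCons c h) T)) $$ (i,j)
      = (char_poly_matrix T * Q') $$ (i,j)"
      unfolding IHij using ij T by (auto simp: poly_mat_pCons carrier_matD[OF poly_mat_carrier] algebra_simps)
  qed (use T Q' in \<open>auto simp: carrier_matD[OF poly_mat_carrier] char_poly_matrix_def\<close>)
  with Q' show ?case by blast
qed

text \<open>Both \<open>f I\<close> (by the adjugate) and \<open>f I - f(T)\<close> are left multiples of \<open>x I - T\<close>, hence so is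
  the constant matrix \<open>f(T)\<close>; comparing degrees, it vanishes.\<close>

lemma cayley_hamilton: "poly_mat (char_poly T) T = 0\<^sub>m N N"
proof -
  let ?X = "char_poly_matrix T" and ?f = "char_poly T"
  let ?C = "map_mat (\<lambda>c. [:c:]) :: 'a mat \<Rightarrow> 'a poly mat"
  have X: "?X \<in> carrier_mat N N" using T by simp
  obtain Q where Q: "Q \<in> carrier_mat N N" and XQ: "?f \<cdot>\<^sub>m 1\<^sub>m N - ?C (poly_mat ?f T) = ?X * Q"
    using char_poly_matrix_dvd by blast
  define R where "R = adj_mat ?X - Q"
  have adj: "adj_mat ?X \<in> carrier_mat N N" "?X * adj_mat ?X = ?f \<cdot>\<^sub>m 1\<^sub>m N"
    using adj_mat[OF X] by (auto simp: char_poly_def)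
  have R: "R \<in> carrier_mat N N" unfolding R_def using Q by (rule minus_carrier_mat)
  have XR: "?X * R = ?C (poly_mat ?f T)"
  proof -
    have "?X * R = ?X * adj_mat ?X - ?X * Q"
      unfolding R_def using X adj Q by (simp add: mult_minus_distrib_mat)
    also have "\<dots> = ?C (poly_mat ?f T)"
      unfolding adj(2) XQ[symmetric]
      by (intro eq_matI) (auto simp: carrier_matD[OF poly_mat_carrier])
    finally show ?thesis .
  qed
  have R0: "R $$ (i,j) = 0" if ij: "i < N" "j < N" for i j
  proof (rule ccontr)
    assume nz: "R $$ (i,j) \<noteq> 0"
    \<comment> \<open>Left multiplication acts column by column, so column j is examined alone. Its
      entry of largest degree is raised to degree \<open>Suc (Max D)\<close>, where nothing can
      cancel it, while a constant matrix has no such coefficient.\<close>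
    define D where "D = {degree (R $$ (k,j)) | k. k < N \<and> R $$ (k,j) \<noteq> 0}"
    have fin: "finite D" by (auto simp: D_def)
    have ne: "D \<noteq> {}" using nz ij by (auto simp: D_def)
    obtain k where k: "k < N" "R $$ (k,j) \<noteq> 0" "degree (R $$ (k,j)) = Max D"
      using Max_in[OF fin ne] by (auto simp: D_def)
    have "coeff (R $$ (l,j)) (Suc (Max D)) = 0" if "l < N" for l
    proof (cases "R $$ (l,j) = 0")
      case False
      then have "degree (R $$ (l,j)) \<in> D" using that by (auto simp: D_def)
    then have "degree (R $$ (l,j)) \<le> Max D" by (rule Max_ge[OF fin])
      then show ?thesis by (intro coeff_eq_0) auto
    qed simp
    then have "coeff ((?X * R) $$ (k,j)) (Suc (Max D)) = coeff (R $$ (k,j)) (Max D)"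
      using char_poly_matrix_mult_index[OF R k(1) ij(2)] by (simp add: coeff_sum)
    moreover have "coeff ((?X * R) $$ (k,j)) (Suc (Max D)) = 0"
      unfolding XR using k(1) ij(2) by (simp add: carrier_matD[OF poly_mat_carrier])
    ultimately show False using k by (metis leading_coeff_0_iff)
  qed
  show ?thesis
  proof (rule eq_matI)
    fix i j assume "i < dim_row (0\<^sub>m N N :: 'a mat)" "j < dim_col (0\<^sub>m N N :: 'a mat)"
    then have ij: "i < N" "j < N" by auto
    have "[:poly_mat ?f T $$ (i,j):] = (?X * R) $$ (i,j)"
      unfolding XR using ij by (simp add: carrier_matD[OF poly_mat_carrier])
    also have "\<dots> = 0"
      using char_poly_matrix_mult_index[OF R ij] ij by (simp add: R0)
    finally show "poly_mat ?f T $$ (i,j) = 0\<^sub>m N N $$ (i,j)" using ij by simp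
  qed (auto simp: carrier_matD[OF poly_mat_carrier])
qed

text \<open>Here h I is itself a multiple of x I - T; take determinants. Consequently every prime
  factor of the characteristic polynomial divides any h that annihilates T.\<close>

lemma char_poly_dvd_power:
  assumes "poly_mat h T = 0\<^sub>m N N"
  shows "char_poly T dvd h ^ N"
proof -
  have X: "char_poly_matrix T \<in> carrier_mat N N" using T by simp
  obtain Q where Q: "Q \<in> carrier_mat N N"
    and "h \<cdot>\<^sub>m 1\<^sub>m N - map_mat (\<lambda>c. [:c:]) (poly_mat h T) = char_poly_matrix T * Q"
    using char_poly_matrix_dvd by blast
  moreover have "h \<cdot>\<^sub>m 1\<^sub>m N - map_mat (\<lambda>c. [:c:]) (poly_mat h T) = h \<cdot>\<^sub>m 1\<^sub>m N"
    unfolding assms by (intro eq_matI) auto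
  ultimately have "det (h \<cdot>\<^sub>m 1\<^sub>m N) = det (char_poly_matrix T * Q)" by simp
  then have "h ^ N = char_poly T * det Q" using det_mult[OF X Q] by (simp add: char_poly_def)
  then show ?thesis by simp
qed

end

section \<open>Cyclic vectors of separable operators\<close>

lemma separable_imp_squarefree:
  fixes f :: "'a::field poly"
  assumes "coprime f (pderiv f)" and "p * p dvd f"
  shows "degree p = 0"
proof -
  obtain r where r: "f = p * (p * r)" using assms(2) by (auto simp: dvd_def mult.assoc)
  then have "p dvd f" by simp
  moreover have "p dvd pderiv f" unfolding r by (simp add: pderiv_mult[of p "p * r"] pderiv_mult[of p r])
  ultimately have "is_unit p" using assms(1) by (meson coprime_common_divisor)
  then show ?thesis by (auto elim: is_unit_polyE)
qed

text \<open>A vector killed by exactly the multiples of \<open>f\<close>: add up, over the prime divisors \<open>p\<close> of \<open>f\<close>,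
  nonzero vectors killed by \<open>p\<close>. They exist because \<open>f/p\<close> does not kill the whole space.\<close>

lemma exists_cyclic_vector:
  fixes T :: "'a::field mat"
  assumes T: "T \<in> carrier_mat N N" and sep: "coprime (char_poly T) (pderiv (char_poly T))"
  shows "\<exists>v \<in> carrier_vec N. \<forall>h. poly_mat h T *\<^sub>v v = 0\<^sub>v N \<longleftrightarrow> char_poly T dvd h"
proof -
  define f where "f = char_poly T"
  note carr [simp] = poly_mat_carrier[OF T]
  have monic: "lead_coeff f = 1" using degree_monic_char_poly[OF T] by (simp add: f_def)
  then have "f \<noteq> 0" by auto
  have sqf: "degree p = 0" if "p * p dvd f" for p
    using that unfolding f_def by (rule separable_imp_squarefree[OF sep])
  have zero: "poly_mat h T *\<^sub>v 0\<^sub>v N = 0\<^sub>v N" for h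
    by (intro eq_vecI) (auto simp: carrier_matD[OF carr])
  have dvd_kills: "poly_mat h T *\<^sub>v v = 0\<^sub>v N"
    if gh: "g dvd h" "poly_mat g T *\<^sub>v v = 0\<^sub>v N" "v \<in> carrier_vec N" for g h v
  proof -
    obtain k where "h = k * g" using gh(1) by (auto simp: dvd_def mult.commute)
    then show ?thesis using gh by (simp add: poly_mat_mult_vec[OF T] zero)
  qed
  \<comment> \<open>Generalised from f to all its divisors g, so that the induction can strip off
    one prime factor at a time.\<close>
  have "\<exists>v \<in> carrier_vec N. \<forall>h. poly_mat h T *\<^sub>v v = 0\<^sub>v N \<longleftrightarrow> g dvd h" if "g dvd f" for g
    using that
  proof (induction "degree g" arbitrary: g rule: less_induct)
    case less
    show ?case
    proof (cases "degree g = 0")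
      case True
      then have "is_unit g" using less.prems \<open>f \<noteq> 0\<close> by (metis dvd_0_left is_unit_iff_degree)
      then show ?thesis using zero by (intro bexI[of _ "0\<^sub>v N"]) (auto intro: unit_imp_dvd)
    next
      case False
      then obtain p where p: "p dvd g" "degree p > 0"
        and prime: "\<forall>h. p dvd h \<or> (\<exists>u v. u * p + v * h = 1)"
        using poly_prime_divisor by blast
      obtain g' where g': "g = p * g'" using p(1) by (auto simp: dvd_def)
      have "g \<noteq> 0" using less.prems \<open>f \<noteq> 0\<close> by auto
      then have "degree g' < degree g" using g' p(2) by (auto simp: degree_mult_eq)
      moreover have "g' dvd f" using g' less.prems by (meson dvd_mult_right)
      ultimately obtain v where v: "v \<in> carrier_vec N"
        and annv: "\<And>h. poly_mat h T *\<^sub>v v = 0\<^sub>v N \<longleftrightarrow> g' dvd h"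
        using less.hyps by blast
      obtain m where m: "f = p * m" using less.prems p(1) by (meson dvdE dvd_trans)
      \<comment> \<open>Otherwise f, hence p, would divide a power of m = f/p, and then p would
        divide f twice.\<close>
      have "poly_mat m T \<noteq> 0\<^sub>m N N"
      proof
        assume "poly_mat m T = 0\<^sub>m N N"
        then have "f dvd m ^ N" unfolding f_def by (rule char_poly_dvd_power[OF T])
        then have "p dvd m" using m prime p(2) by (meson dvd_mult_left poly_prime_dvd_power)
        then have "p * p dvd f" using m by simp
        then have "degree p = 0" by (rule sqf)
          then show False using p(2) by simp
      qed
      then obtain w where w: "w \<in> carrier_vec N" "poly_mat m T *\<^sub>v w \<noteq> 0\<^sub>v N"
      proof -
        have "\<exists>j<N. poly_mat m T *\<^sub>v unit_vec N j \<noteq> 0\<^sub>v N"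
        proof (rule ccontr)
          assume "\<not> ?thesis"
          then have "poly_mat m T = 0\<^sub>m N N"
            by (intro mat_col_eqI) (auto simp: mult_mat_vec_unit[of _ N N] carrier_matD[OF carr])
          then show False using \<open>poly_mat m T \<noteq> 0\<^sub>m N N\<close> by blast
        qed
        then show thesis using that unit_vec_carrier by blast
      qed
      define u where "u = poly_mat m T *\<^sub>v w"
      have u: "u \<in> carrier_vec N" "u \<noteq> 0\<^sub>v N" using w by (auto simp: u_def intro: mult_mat_vec_carrier[of _ N N])
      have pu: "poly_mat p T *\<^sub>v u = 0\<^sub>v N"
      proof -
        have "poly_mat p T *\<^sub>v u = poly_mat f T *\<^sub>v w"
          using w by (simp add: m u_def poly_mat_mult_vec[OF T])
        also have "\<dots> = 0\<^sub>v N" unfolding f_def cayley_hamilton[OF T] using w by (intro eq_vecI) auto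
        finally show ?thesis .
      qed
      have add: "poly_mat h T *\<^sub>v (v + u) = poly_mat h T *\<^sub>v v + poly_mat h T *\<^sub>v u" for h
        using u v by (simp add: mult_add_distrib_mat_vec[of _ N N])
      have "poly_mat h T *\<^sub>v (v + u) = 0\<^sub>v N \<longleftrightarrow> g dvd h" for h
      proof
        assume "g dvd h"
        then have "p dvd h" "g' dvd h" using g' by (auto dest: dvd_mult_left dvd_mult_right)
        then have "poly_mat h T *\<^sub>v u = 0\<^sub>v N" "poly_mat h T *\<^sub>v v = 0\<^sub>v N"
          using dvd_kills pu u annv by blast+
        then show "poly_mat h T *\<^sub>v (v + u) = 0\<^sub>v N" unfolding add by simp
      next
        assume h: "poly_mat h T *\<^sub>v (v + u) = 0\<^sub>v N"
        \<comment> \<open>Multiplying by p removes u and leaves g' dividing p h. As p and g' are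
          coprime, g' divides h, so h kills v and therefore u; if p did not divide h, a Bezout
          identity would force u = 0.\<close>
        have "poly_mat (p * h) T *\<^sub>v (v + u) = 0\<^sub>v N"
          using dvd_kills[OF _ h, of "p * h"] u v by simp
        moreover have "poly_mat (p * h) T *\<^sub>v u = 0\<^sub>v N"
          using dvd_kills[OF _ pu, of "p * h"] u by simp
        moreover have "poly_mat (p * h) T *\<^sub>v v \<in> carrier_vec N" using v by (intro mult_mat_vec_carrier[of _ N N]) auto
        ultimately have "g' dvd p * h" unfolding add using annv by simp
        have "\<not> p dvd g'"
        proof
          assume "p dvd g'"
          then have "p * p dvd f" using less.prems unfolding g' by (meson dvd_trans mult_dvd_mono dvd_refl)
          then have "degree p = 0" by (rule sqf)
          then show False using p(2) by simp
        qed
        then obtain s t where st: "s * p + t * g' = 1" using prime by blast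
        have eq: "h = s * (p * h) + t * (g' * h)"
        proof -
          have "h = (s * p + t * g') * h" by (simp add: st)
          then show ?thesis by (simp add: algebra_simps)
        qed
        have "g' dvd s * (p * h) + t * (g' * h)" by (intro dvd_add dvd_mult[OF \<open>g' dvd p * h\<close>]) simp
        then have "g' dvd h" using eq by simp
        then have "poly_mat h T *\<^sub>v v = 0\<^sub>v N" using annv by blast
        moreover have "poly_mat h T *\<^sub>v u \<in> carrier_vec N" using u by (intro mult_mat_vec_carrier[of _ N N]) auto
        ultimately have hu: "poly_mat h T *\<^sub>v u = 0\<^sub>v N" using h unfolding add by simp
        have "p dvd h"
        proof (rule ccontr)
          assume "\<not> p dvd h"
          then obtain a b where "a * p + b * h = 1" using prime by blast
          then have "u = poly_mat (a * p + b * h) T *\<^sub>v u" using u by (simp add: poly_mat_1[OF T])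
          also have "\<dots> = 0\<^sub>v N"
            using u hu pu zero by (simp add: poly_mat_add_vec[OF T] poly_mat_mult_vec[OF T])
          finally show False using u by simp
        qed
        then have "p * g' dvd s * (p * h) + t * (g' * h)" using \<open>g' dvd h\<close>
          by (intro dvd_add[OF dvd_mult dvd_mult]) (simp_all add: mult.commute[of p g'] mult_dvd_mono \<open>p dvd h\<close>)
        then show "g dvd h" using eq g' by simp
      qed
      then show ?thesis using u v by (intro bexI[of _ "v + u"]) auto
    qed
  qed
  from this[OF dvd_refl] show ?thesis unfolding f_def .
qed

section \<open>The algebra L and its trace pairing\<close>

lemma linear_functional_expand:
  fixes \<phi> :: "'a::field poly \<Rightarrow> 'a"
  assumes add: "\<And>g h. \<phi> (g + h) = \<phi> g + \<phi> h"
    and smult: "\<And>c g. \<phi> (Polynomial.smult c g) = c * \<phi> g"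
    and deg: "degree g < N"
  shows "\<phi> g = (\<Sum>j<N. coeff g j * \<phi> (monom 1 j))"
proof -
  have zero: "\<phi> 0 = 0" using smult[of 0 0] by simp
  have sum: "\<phi> (\<Sum>j\<in>A. h j) = (\<Sum>j\<in>A. \<phi> (h j))" if "finite A" for A and h :: "nat \<Rightarrow> 'a poly"
    using that by (induction A) (auto simp: zero add)
  obtain m where m: "N = Suc m" using deg by (cases N) auto
  have "g = (\<Sum>j<N. monom (coeff g j) j)"
    using poly_as_sum_of_monoms'[of g m] deg by (simp add: m lessThan_Suc_atMost)
  then have "\<phi> g = (\<Sum>j<N. \<phi> (monom (coeff g j) j))" using sum by (metis finite_lessThan)
  also have "\<dots> = (\<Sum>j<N. coeff g j * \<phi> (monom 1 j))"
    by (intro sum.cong refl) (metis smult smult_monom mult.right_neutral)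
  finally show ?thesis .
qed

locale monic_quotient =
  fixes f :: "'a::field poly" and N :: nat
  assumes monic: "lead_coeff f = 1" and deg: "degree f = N" and pos: "N > 0"
begin

text \<open>Euler: \<open>lam g\<close> is the trace of \<open>g / f'(\<beta>)\<close>.\<close>

definition lam :: "'a poly \<Rightarrow> 'a" where
  "lam g = coeff (g mod f) (N - 1)"

text \<open>Defined on all polynomials, so elements of L need no canonical representatives: equal
  vectors mean congruence modulo f.\<close>

definition cvec :: "'a poly \<Rightarrow> 'a vec" where
  "cvec g = vec N (\<lambda>i. coeff (g mod f) i)"

lemma f_nz: "f \<noteq> 0"
  using monic by auto

lemma degree_mod_f: "degree (g mod f) < N"
  using degree_mod_less[OF f_nz, of g] pos deg by auto

lemma mod_f_id: "degree g < N \<Longrightarrow> g mod f = g"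
  by (simp add: mod_poly_less deg)

lemma lam_add: "lam (g + h) = lam g + lam h"
  by (simp add: lam_def poly_mod_add_left)

lemma lam_smult: "lam (Polynomial.smult c g) = c * lam g"
  by (simp add: lam_def mod_smult_left)

lemma lam_0 [simp]: "lam 0 = 0"
  by (simp add: lam_def)

lemma lam_sum: "lam (\<Sum>i\<in>A. h i) = (\<Sum>i\<in>A. lam (h i))"
  by (induction A rule: infinite_finite_induct) (auto simp: lam_add)

lemma lam_cong: "g mod f = h mod f \<Longrightarrow> lam g = lam h"
  by (simp add: lam_def)

lemma lam_mult_expand: "lam (a * g) = (\<Sum>j<N. coeff (g mod f) j * lam (a * monom 1 j))"
proof -
  have "lam (a * g) = lam (a * (g mod f))" by (rule lam_cong) (simp add: mod_mult_right_eq)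
  also have "\<dots> = (\<Sum>j<N. coeff (g mod f) j * lam (a * monom 1 j))"
    by (rule linear_functional_expand[of "\<lambda>g. lam (a * g)"])
      (auto simp: lam_add lam_smult distrib_left degree_mod_f)
  finally show ?thesis .
qed

text \<open>Euler's dual basis: the \<open>poly_shift (Suc j) f\<close> are the coefficients of \<open>f(X)/(X - x)\<close>.\<close>

lemma lam_poly_shift_monom:
  assumes "i < N" "j < N"
  shows "lam (poly_shift (Suc j) f * monom 1 i) = (if i = j then 1 else 0)"
proof (cases "i \<le> j")
  \<comment> \<open>The product has degree below N and needs no reduction. The coefficient read off
    is that of f at \<open>N + (j - i)\<close>: the leading one for i = j, beyond the degree
    otherwise.\<close>
  case True
  have "degree (monom 1 i * poly_shift (Suc j) f) \<le> N - 1"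
    using True assms deg by (intro degree_le) (auto simp: coeff_monom_mult coeff_poly_shift intro!: coeff_eq_0)
  then have "monom 1 i * poly_shift (Suc j) f mod f = monom 1 i * poly_shift (Suc j) f"
    using pos by (intro mod_f_id) auto
  then have "lam (poly_shift (Suc j) f * monom 1 i) = coeff f (N - 1 - i + Suc j)"
    using assms by (simp add: lam_def mult.commute coeff_monom_mult coeff_poly_shift)
  also have "\<dots> = (if i = j then 1 else 0)"
    using True assms monic deg by (auto intro!: coeff_eq_0)
  finally show ?thesis .
next
  case False
  \<comment> \<open>Splitting f into its terms below and from degree \<open>Suc j\<close> on shows
    that the product is -r modulo f. Since r has degree at most i - 1, it stays below the top degree
    N - 1.\<close>
  define r where "r = monom 1 (i - Suc j) * poly_cutoff (Suc j) f"
  have "poly_shift (Suc j) f * monom 1 i = monom 1 (i - Suc j) * f - r"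
  proof (rule poly_eqI)
    fix k
    have "k - i + Suc j = k - (i - Suc j)" if "i \<le> k" using that False by auto
    moreover have "k - (i - Suc j) < Suc j \<longleftrightarrow> k < i" if "i - Suc j \<le> k" using that False by auto
    ultimately show "coeff (poly_shift (Suc j) f * monom 1 i) k = coeff (monom 1 (i - Suc j) * f - r) k"
      unfolding r_def mult.commute[of _ "monom 1 i"]
      by (auto simp: coeff_monom_mult coeff_poly_shift coeff_poly_cutoff)
  qed
  then have "lam (poly_shift (Suc j) f * monom 1 i) = lam (- r)"
    by (intro lam_cong) (simp add: poly_mod_diff_left)
  moreover have "degree (- r) < N"
    using assms False unfolding degree_minus r_def
    by (intro le_less_trans[OF degree_le[of "i - 1"]]) (auto simp: coeff_monom_mult coeff_poly_cutoff)
  moreover have "coeff r (N - 1) = 0"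
    using assms False by (auto simp: r_def coeff_monom_mult coeff_poly_cutoff)
  ultimately show ?thesis using False by (simp add: lam_def mod_f_id)
qed

text \<open>Duality makes coordinates into values of \<open>lam\<close>, which is how a trace of a
  matrix becomes a value of \<open>lam\<close>.\<close>

lemma lam_poly_shift:
  assumes "j < N"
  shows "lam (poly_shift (Suc j) f * g) = coeff (g mod f) j"
  unfolding lam_mult_expand[of _ g] using assms
  by (simp add: lam_poly_shift_monom if_distrib[of "(*) _"] cong: if_cong)

text \<open>This is f(X)/(X - x) evaluated at X = x. On coefficients: the term of f in degree k + 1
  is shifted to degree k once for each i from 0 to k.\<close>

lemma sum_poly_shift_monom: "(\<Sum>i<N. poly_shift (Suc i) f * monom 1 i) = pderiv f"
proof (rule poly_eqI)
  fix k
  have "coeff (\<Sum>i<N. poly_shift (Suc i) f * monom 1 i) k = (\<Sum>i<N. if i \<le> k then coeff f (Suc k) else 0)"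
    unfolding coeff_sum
    by (intro sum.cong refl, subst mult.commute) (auto simp: coeff_monom_mult coeff_poly_shift)
  also have "\<dots> = of_nat (Suc k) * coeff f (Suc k)"
  proof (cases "Suc k \<le> N")
    case True
    then have "{..<N} \<inter> {i. i \<le> k} = {..k}" by auto
    then show ?thesis by (simp add: sum.If_cases)
  qed (use deg in \<open>auto simp: coeff_eq_0\<close>)
  finally show "coeff (\<Sum>i<N. poly_shift (Suc i) f * monom 1 i) k = coeff (pderiv f) k"
    by (simp add: coeff_pderiv)
qed

text \<open>The diagonal entries are values of \<open>lam\<close> on dual basis elements times basis
  elements, and these products add up to f'.\<close>

lemma L_trace_eq: "L_trace f a = lam (a * pderiv f)"
proof -
  have "L_trace f a = (\<Sum>i<N. coeff ((a * monom 1 i) mod f) i)"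
    by (simp add: L_trace_def mat_trace_def L_mult_mat_def deg)
  also have "\<dots> = (\<Sum>i<N. lam (a * (poly_shift (Suc i) f * monom 1 i)))"
    by (intro sum.cong refl) (simp add: lam_poly_shift[symmetric] mult.left_commute)
  also have "\<dots> = lam (a * pderiv f)"
    by (simp only: sum_poly_shift_monom[symmetric] sum_distrib_left lam_sum)
  finally show ?thesis .
qed

text \<open>Vanishing on all monomials implies vanishing on the dual basis, whose values are the
  coordinates of g.\<close>

lemma lam_nondegenerate:
  assumes "\<And>i. i < N \<Longrightarrow> lam (g * monom 1 i) = 0"
  shows "g mod f = 0"
proof (rule poly_eqI)
  fix j
  have "coeff (g mod f) j = 0" if "j < N"
    using lam_mult_expand[of g "poly_shift (Suc j) f"] assms
    by (simp add: lam_poly_shift[OF that, symmetric] mult.commute)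
  then show "coeff (g mod f) j = coeff 0 j"
    using degree_mod_f[of g] by (cases "j < N") (auto intro: coeff_eq_0)
qed

lemma lam_represents: "\<exists>a. \<forall>i<N. lam (a * monom 1 i) = \<mu> i"
proof (intro exI allI impI)
  fix i assume "i < N"
  then show "lam ((\<Sum>j<N. Polynomial.smult (\<mu> j) (poly_shift (Suc j) f)) * monom 1 i) = \<mu> i"
    by (simp add: sum_distrib_right lam_sum lam_smult lam_poly_shift_monom if_distrib[of "(*) _"] cong: if_cong)
qed

section \<open>Coordinates and multiplication operators on L\<close>

lemma cvec_carrier [simp]: "cvec g \<in> carrier_vec N"
  by (simp add: cvec_def)

lemma cvec_index [simp]: "i < N \<Longrightarrow> cvec g $ i = coeff (g mod f) i"
  by (simp add: cvec_def)

lemma dim_cvec [simp]: "dim_vec (cvec g) = N"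
  by (simp add: cvec_def)

lemma cvec_eq_iff: "cvec g = cvec h \<longleftrightarrow> g mod f = h mod f"
proof
  assume "cvec g = cvec h"
  then have "coeff (g mod f) i = coeff (h mod f) i" if "i < N" for i
    using that by (metis cvec_index)
  moreover have "coeff (g mod f) i = 0" "coeff (h mod f) i = 0" if "\<not> i < N" for i
    using that degree_mod_f[of g] degree_mod_f[of h] by (auto intro: coeff_eq_0)
  ultimately show "g mod f = h mod f" by (intro poly_eqI) metis
qed (simp add: cvec_def)

lemma cvec_add: "cvec (g + h) = cvec g + cvec h"
  by (intro eq_vecI) (auto simp: poly_mod_add_left)

lemma cvec_smult: "cvec (Polynomial.smult c g) = c \<cdot>\<^sub>v cvec g"
  by (intro eq_vecI) (auto simp: mod_smult_left)

lemma cvec_0 [simp]: "cvec 0 = 0\<^sub>v N"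
  by (intro eq_vecI) auto

lemma cvec_monom: "j < N \<Longrightarrow> cvec (monom 1 j) = unit_vec N j"
  by (intro eq_vecI) (auto simp: mod_f_id degree_monom_eq)

lemma cvec_surj:
  assumes "v \<in> carrier_vec N"
  shows "\<exists>g. cvec g = v"
proof -
  define g where "g = (\<Sum>j<N. monom (v $ j) j)"
  have cg: "coeff g i = (if i < N then v $ i else 0)" for i
    by (simp add: g_def coeff_sum)
  have "degree g < N" using pos cg by (intro le_less_trans[OF degree_le[of "N - 1"]]) auto
  then have "cvec g = v" using assms by (intro eq_vecI) (auto simp: mod_f_id cg)
  then show ?thesis by blast
qed

lemma mat_eq_cvec:
  assumes "A \<in> carrier_mat nr N" "A' \<in> carrier_mat nr N" "\<And>g. A *\<^sub>v cvec g = A' *\<^sub>v cvec g"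
  shows "A = A'"
proof (rule mat_col_eqI)
  fix j assume "j < dim_col A'"
  then have "j < N" using assms by auto
  then show "col A j = col A' j"
    using assms(3)[of "monom 1 j"] assms(1,2) by (simp add: cvec_monom mult_mat_vec_unit)
qed (use assms in auto)

lemma L_mult_mat_carrier [simp]: "L_mult_mat f a \<in> carrier_mat N N"
  by (simp add: L_mult_mat_def deg)

lemma L_mult_mat_mult_vec: "L_mult_mat f a *\<^sub>v cvec g = cvec (a * g)"
proof (rule eq_vecI)
  fix i assume "i < dim_vec (cvec (a * g))"
  then have i: "i < N" by simp
  have "cvec (a * g) $ i = coeff ((a * (g mod f)) mod f) i" using i by (simp add: mod_mult_right_eq)
  also have "\<dots> = (\<Sum>j<N. coeff (g mod f) j * coeff ((a * monom 1 j) mod f) i)"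
    by (rule linear_functional_expand[of "\<lambda>g. coeff ((a * g) mod f) i"])
      (auto simp: distrib_left poly_mod_add_left mod_smult_left degree_mod_f)
  also have "\<dots> = (L_mult_mat f a *\<^sub>v cvec g) $ i"
    using i by (auto simp: L_mult_mat_def deg scalar_prod_def atLeast0LessThan mult.commute intro!: sum.cong)
  finally show "(L_mult_mat f a *\<^sub>v cvec g) $ i = cvec (a * g) $ i" by simp
qed (simp add: L_mult_mat_def deg)

lemma L_mult_mat_mult: "L_mult_mat f a * L_mult_mat f b = L_mult_mat f (a * b)"
  by (rule mat_eq_cvec[of _ N])
    (auto simp: L_mult_mat_mult_vec assoc_mult_mat_vec[of _ N N _ N] mult.assoc
      intro: mult_carrier_mat[of _ N N])

lemma L_mult_mat_cong: "a mod f = b mod f \<Longrightarrow> L_mult_mat f a = L_mult_mat f b"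
  by (rule mat_eq_cvec[of _ N]) (auto simp: L_mult_mat_mult_vec cvec_eq_iff intro: mod_mult_cong)

lemma L_mult_mat_1: "L_mult_mat f 1 = 1\<^sub>m N"
  by (rule mat_eq_cvec[of _ N]) (auto simp: L_mult_mat_mult_vec)

text \<open>The preimage of 1 under a bijective multiplication is the inverse element.\<close>

lemma L_mult_mat_invertible_iff: "invertible_mat (L_mult_mat f u) \<longleftrightarrow> L_unit f u"
proof
  assume "invertible_mat (L_mult_mat f u)"
  then obtain A where A: "A \<in> carrier_mat N N" "L_mult_mat f u * A = 1\<^sub>m N"
    using invertible_matE[OF L_mult_mat_carrier] by metis
  obtain b where b: "cvec b = A *\<^sub>v cvec 1"
    using cvec_surj[of "A *\<^sub>v cvec 1"] A by auto
  have "cvec (u * b) = L_mult_mat f u *\<^sub>v (A *\<^sub>v cvec 1)" by (simp add: L_mult_mat_mult_vec flip: b)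
  also have "\<dots> = cvec 1" using A by (simp add: assoc_mult_mat_vec[of _ N N _ N, symmetric])
  finally show "L_unit f u" by (auto simp: L_unit_def cvec_eq_iff)
next
  assume "L_unit f u"
  then obtain b where "(u * b) mod f = 1 mod f" by (auto simp: L_unit_def)
  then have "L_mult_mat f u * L_mult_mat f b = 1\<^sub>m N"
    by (metis L_mult_mat_mult L_mult_mat_cong L_mult_mat_1)
  then show "invertible_mat (L_mult_mat f u)"
    by (intro invertible_matI[of _ N]) auto
qed

lemma poly_mat_L_mult_mat_X: "poly_mat h (L_mult_mat f [:0,1:]) *\<^sub>v cvec g = cvec (h * g)"
proof (induction h)
  case 0
  then show ?case
    by (simp add: poly_mat_0[OF L_mult_mat_carrier]) (intro eq_vecI, auto)
next
  case (pCons c h)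
  let ?C = "L_mult_mat f [:0,1:]"
  have "poly_mat (pCons c h) ?C *\<^sub>v cvec g
      = (c \<cdot>\<^sub>m 1\<^sub>m N) *\<^sub>v cvec g + ?C *\<^sub>v (poly_mat h ?C *\<^sub>v cvec g)"
    unfolding poly_mat_pCons[OF L_mult_mat_carrier]
    by (subst add_mult_distrib_mat_vec[of _ N N])
      (auto simp: assoc_mult_mat_vec[of _ N N _ N] poly_mat_carrier[OF L_mult_mat_carrier] intro: mult_carrier_mat[of _ N N])
  also have "(c \<cdot>\<^sub>m 1\<^sub>m N) *\<^sub>v cvec g = c \<cdot>\<^sub>v cvec g"
    by (intro eq_vecI) auto
  also have "\<dots> + ?C *\<^sub>v (poly_mat h ?C *\<^sub>v cvec g) = cvec (pCons c h * g)"
    unfolding pCons.IH by (simp add: L_mult_mat_mult_vec cvec_smult cvec_add)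
  finally show ?case .
qed

text \<open>No determinant is expanded: Cayley-Hamilton applied to the vector 1 shows that f divides
  the characteristic polynomial, and both are monic of degree N.\<close>

lemma char_poly_L_mult_mat_X: "char_poly (L_mult_mat f [:0,1:]) = f"
proof -
  let ?p = "char_poly (L_mult_mat f [:0,1:])"
  have "cvec (?p * 1) = 0\<^sub>v N"
    unfolding poly_mat_L_mult_mat_X[symmetric]
    by (simp add: cayley_hamilton[OF L_mult_mat_carrier]) (intro eq_vecI, auto)
  then have "?p mod f = 0" using cvec_eq_iff[of ?p 0] by simp
  then obtain q where q: "?p = f * q" unfolding mod_eq_0_iff_dvd dvd_def by blast
  have p: "degree ?p = N" "coeff ?p N = 1"
    using degree_monic_char_poly[OF L_mult_mat_carrier] by auto
  then have "q \<noteq> 0" using q pos by auto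
  then have "degree q = 0" using q p deg f_nz by (simp add: degree_mult_eq)
  then obtain c where c: "q = [:c:]" by (metis degree_eq_zeroE)
  have "coeff ?p N = c * coeff f N" using q c by simp
  then have "c = 1" using p monic deg by simp
  then show ?thesis using q c by simp
qed

text \<open>1 generates L under \<beta>, so an operator commuting with \<beta> is determined by the
  image u of 1.\<close>

lemma commutant_L_mult_mat_X:
  assumes h: "h \<in> carrier_mat N N" and comm: "h * L_mult_mat f [:0,1:] = L_mult_mat f [:0,1:] * h"
  shows "\<exists>u. h = L_mult_mat f u"
proof -
  let ?C = "L_mult_mat f [:0,1:]"
  obtain u where u: "cvec u = h *\<^sub>v cvec 1" using cvec_surj[of "h *\<^sub>v cvec 1"] h by auto
  have "h *\<^sub>v cvec g = cvec (u * g)" for g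
  proof (induction g)
    case 0
    then show ?case using h by (auto intro: eq_vecI)
  next
    case (pCons c g)
    have "pCons c g = Polynomial.smult c 1 + [:0,1:] * g" by simp
    then have "cvec (pCons c g) = c \<cdot>\<^sub>v cvec 1 + ?C *\<^sub>v cvec g"
      by (simp only: cvec_add cvec_smult L_mult_mat_mult_vec)
    moreover have "?C *\<^sub>v cvec g \<in> carrier_vec N" by (simp add: L_mult_mat_mult_vec)
    ultimately have "h *\<^sub>v cvec (pCons c g) = c \<cdot>\<^sub>v (h *\<^sub>v cvec 1) + h *\<^sub>v (?C *\<^sub>v cvec g)"
      using h by (simp add: mult_add_distrib_mat_vec[of _ N N] mult_mat_vec[of _ N N])
    also have "h *\<^sub>v (?C *\<^sub>v cvec g) = ?C *\<^sub>v (h *\<^sub>v cvec g)"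
      using h comm by (metis assoc_mult_mat_vec L_mult_mat_carrier cvec_carrier)
    also have "c \<cdot>\<^sub>v (h *\<^sub>v cvec 1) + ?C *\<^sub>v (h *\<^sub>v cvec g) = cvec (u * pCons c g)"
      by (simp add: pCons.IH L_mult_mat_mult_vec cvec_add cvec_smult flip: u)
    finally show ?case .
  qed
  then show ?thesis
    using h by (intro exI[of _ u] mat_eq_cvec[of _ N]) (auto simp: L_mult_mat_mult_vec)
qed

end

section \<open>The pairings on L for separable f\<close>

locale separable_quotient = monic_quotient +
  assumes sep: "coprime f (pderiv f)"
begin

lemma L_inv_pderiv: "(pderiv f * L_inv f (pderiv f)) mod f = 1 mod f"
proof -
  obtain u v where "u * f + v * pderiv f = 1" using poly_coprime_bezout[OF sep] by blast
  then have "(pderiv f * v) mod f = 1 mod f"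
    by (metis mod_mult_self3 mult.commute)
  then show ?thesis unfolding L_inv_def by (rule someI)
qed

text \<open>The factor f' produced by Euler's trace formula cancels the 1/f' in the pairing; from
  here on the trace no longer appears.\<close>

lemma pairing_gram_eq: "pairing_gram f a = mat N N (\<lambda>(i,j). lam (a * monom 1 i * monom 1 j))"
proof -
  have "L_trace f (b * L_inv f (pderiv f)) = lam b" for b
  proof -
    have "(b * L_inv f (pderiv f) * pderiv f) mod f = (b * ((pderiv f * L_inv f (pderiv f)) mod f)) mod f"
      by (simp add: mod_mult_right_eq ac_simps)
    also have "\<dots> = b mod f" by (simp add: L_inv_pderiv mod_mult_right_eq)
    finally show ?thesis unfolding L_trace_eq by (rule lam_cong)
  qed
  then show ?thesis by (simp add: pairing_gram_def deg)
qed

lemma pairing_gram_carrier [simp]: "pairing_gram f a \<in> carrier_mat N N"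
  by (simp add: pairing_gram_eq)

lemma pairing_gram_mult_vec: "pairing_gram f a *\<^sub>v cvec g = vec N (\<lambda>i. lam (a * monom 1 i * g))"
proof (rule eq_vecI)
  fix i assume "i < dim_vec (vec N (\<lambda>i. lam (a * monom 1 i * g)))"
  then have i: "i < N" by simp
  show "(pairing_gram f a *\<^sub>v cvec g) $ i = vec N (\<lambda>i. lam (a * monom 1 i * g)) $ i"
    using i lam_mult_expand[of "a * monom 1 i" g]
    by (auto simp: pairing_gram_eq scalar_prod_def atLeast0LessThan mult.commute intro!: sum.cong)
qed (simp add: pairing_gram_eq)

lemma pairing_gram_symmetric: "transpose_mat (pairing_gram f a) = pairing_gram f a"
  by (intro eq_matI) (auto simp: pairing_gram_eq ac_simps)

lemma pairing_gram_mult: "pairing_gram f a * L_mult_mat f u = pairing_gram f (a * u)"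
  by (rule mat_eq_cvec[of _ N])
    (auto simp: L_mult_mat_mult_vec pairing_gram_mult_vec assoc_mult_mat_vec[of _ N N _ N] ac_simps
      intro: mult_carrier_mat[of _ N N])

lemma L_mult_mat_transpose_mult:
  "transpose_mat (L_mult_mat f u) * pairing_gram f a = pairing_gram f (a * u)"
  using transpose_mult[of "pairing_gram f a" N N "L_mult_mat f u" N]
  by (simp add: pairing_gram_symmetric pairing_gram_mult)

text \<open>The origin of the squares: a change of coordinates by u acts on both arguments of the
  pairing, and each contributes one factor u to \<alpha>.\<close>

lemma pairing_gram_congruence:
  "transpose_mat (L_mult_mat f u) * pairing_gram f a * L_mult_mat f u = pairing_gram f (a * u * u)"
  by (simp add: L_mult_mat_transpose_mult pairing_gram_mult)

lemma pairing_gram_smult: "pairing_gram f (Polynomial.smult c a) = c \<cdot>\<^sub>m pairing_gram f a"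
  by (intro eq_matI) (auto simp: pairing_gram_eq lam_smult)

text \<open>The first row of the Gram matrix lists the values of \<open>lam\<close> on a times the
  monomials, and by nondegeneracy they determine the residue of a.\<close>

lemma pairing_gram_eq_iff: "pairing_gram f a = pairing_gram f b \<longleftrightarrow> a mod f = b mod f"
proof
  assume eq: "pairing_gram f a = pairing_gram f b"
  have "lam ((a - b) * monom 1 i) = 0" if "i < N" for i
  proof -
    have "pairing_gram f a $$ (0,i) = pairing_gram f b $$ (0,i)" using eq by simp
    then have "lam (a * monom 1 i) = lam (b * monom 1 i)" using that pos by (simp add: pairing_gram_eq monom_0 flip: one_pCons)
    then show ?thesis using lam_add[of "(a - b) * monom 1 i" "b * monom 1 i"] by (simp add: algebra_simps)
  qed
  then have "(a - b) mod f = 0" by (rule lam_nondegenerate)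
  then show "a mod f = b mod f" by (metis mod_eq_dvd_iff mod_eq_0_iff_dvd)
next
  assume "a mod f = b mod f"
  then have "lam (a * h) = lam (b * h)" for h
    by (intro lam_cong) (metis mod_mult_left_eq)
  then show "pairing_gram f a = pairing_gram f b"
    by (simp add: pairing_gram_eq mult.assoc)
qed

lemma pairing_gram_1_invertible: "invertible_mat (pairing_gram f 1)"
  unfolding invertible_mat_iff_kernel[OF pairing_gram_carrier]
proof (intro ballI impI)
  fix v assume v: "v \<in> carrier_vec N" "pairing_gram f 1 *\<^sub>v v = 0\<^sub>v N"
  obtain g where g: "cvec g = v" using cvec_surj[OF v(1)] by blast
  have "lam (g * monom 1 i) = 0" if "i < N" for i
    using arg_cong[OF v(2), of "\<lambda>w. w $ i"] that
    by (simp add: pairing_gram_mult_vec mult.commute flip: g)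
  then have "g mod f = 0" by (rule lam_nondegenerate)
  then show "v = 0\<^sub>v N" using g cvec_eq_iff[of g 0] by simp
qed

text \<open>Ties the norm of \<alpha> to discriminants: it is the ratio of the determinants of two
  pairings.\<close>

lemma det_pairing_gram: "det (pairing_gram f a) = det (pairing_gram f 1) * L_norm f a"
  using det_mult[of "pairing_gram f 1" N "L_mult_mat f a"] by (simp add: pairing_gram_mult L_norm_def)

lemma pairing_gram_invertible_iff: "invertible_mat (pairing_gram f a) \<longleftrightarrow> L_unit f a"
  using pairing_gram_1_invertible L_mult_mat_invertible_iff[of a] det_pairing_gram[of a]
  by (simp add: invertible_mat_iff_det[of _ N] L_norm_def)

text \<open>Choose a to match the first row, that is, the functional given by pairing with 1.
  Self-adjointness of \<beta> moves a factor x from one argument to the other, so each further row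
  follows from the one before.\<close>

lemma exists_pairing_gram:
  assumes G: "G \<in> carrier_mat N N"
    and comm: "transpose_mat (L_mult_mat f [:0,1:]) * G = G * L_mult_mat f [:0,1:]"
  shows "\<exists>a. G = pairing_gram f a"
proof -
  let ?C = "L_mult_mat f [:0,1:]"
  obtain a where a: "\<And>j. j < N \<Longrightarrow> lam (a * monom 1 j) = G $$ (0,j)"
    using lam_represents[of "\<lambda>j. G $$ (0,j)"] by blast
  have *: "(G *\<^sub>v cvec g) $ i = lam (a * monom 1 i * g)" if "i < N" for i g
    using that
  proof (induction i arbitrary: g)
    case 0
    have "(G *\<^sub>v cvec g) $ 0 = (\<Sum>j<N. G $$ (0,j) * coeff (g mod f) j)"
      using G 0 by (auto simp: scalar_prod_def atLeast0LessThan intro!: sum.cong)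
    also have "\<dots> = (\<Sum>j<N. coeff (g mod f) j * lam (a * monom 1 j))"
      by (intro sum.cong refl) (simp add: a mult.commute[of "coeff _ _"])
    finally show ?case by (simp add: lam_mult_expand[of a g] monom_0 flip: one_pCons)
  next
    case (Suc i)
    have w: "G *\<^sub>v cvec g \<in> carrier_vec N" using G by simp
    have col: "col ?C i = unit_vec N (Suc i)"
    proof -
      have "col ?C i = ?C *\<^sub>v cvec (monom 1 i)"
        using Suc.prems by (simp add: cvec_monom mult_mat_vec_unit[of _ N N])
      also have "\<dots> = cvec (monom 1 (Suc i))" by (simp add: L_mult_mat_mult_vec monom_Suc)
      finally show ?thesis using Suc.prems by (simp add: cvec_monom)
    qed
    have "(G *\<^sub>v cvec g) $ Suc i = (transpose_mat ?C *\<^sub>v (G *\<^sub>v cvec g)) $ i"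
      using Suc.prems w by (simp add: col carrier_matD[OF L_mult_mat_carrier])
    also have "transpose_mat ?C *\<^sub>v (G *\<^sub>v cvec g) = G *\<^sub>v (?C *\<^sub>v cvec g)"
      using G comm by (metis assoc_mult_mat_vec L_mult_mat_carrier cvec_carrier transpose_carrier_mat)
    also have "(G *\<^sub>v (?C *\<^sub>v cvec g)) $ i = lam (a * monom 1 (Suc i) * g)"
      using Suc.IH[of "[:0,1:] * g"] Suc.prems by (simp add: L_mult_mat_mult_vec monom_Suc)
    finally show ?case .
  qed
  have "G = pairing_gram f a"
  proof (rule mat_eq_cvec[OF G])
    fix g show "G *\<^sub>v cvec g = pairing_gram f a *\<^sub>v cvec g"
      unfolding pairing_gram_mult_vec using G * by (intro eq_vecI) auto
  qed simp
  then show ?thesis by blast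
qed

text \<open>The isotropic subspace consists of the polynomials of degree below m: their products
  have degree at most 2m - 2 = N - 2 and miss the top coefficient.\<close>

lemma pairing_gram_1_split:
  assumes N: "N = 2 * m"
  shows "split_form (pairing_gram f 1)"
proof -
  have m: "m > 0" using pos N by simp
  define M :: "'a mat" where "M = mat N m (\<lambda>(i,j). if i = j then 1 else 0)"
  have M: "M \<in> carrier_mat N m" by (simp add: M_def)
  have inj: "x = 0\<^sub>v m" if x: "x \<in> carrier_vec m" "M *\<^sub>v x = 0\<^sub>v N" for x
  proof (rule eq_vecI)
    fix i assume "i < dim_vec (0\<^sub>v m :: 'a vec)"
    then have i: "i < m" by simp
    then have "(M *\<^sub>v x) $ i = x $ i"
      using x(1) N by (auto simp: M_def scalar_prod_def if_distrib[of "\<lambda>y. y * _"] cong: if_cong)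
    then show "x $ i = 0\<^sub>v m $ i" using x(2) i N by simp
  qed (use x in auto)
  have "transpose_mat M * pairing_gram f 1 * M = 0\<^sub>m m m"
  proof (rule eq_matI)
    fix i j assume "i < dim_row (0\<^sub>m m m :: 'a mat)" "j < dim_col (0\<^sub>m m m :: 'a mat)"
    then have ij: "i < m" "j < m" by auto
    have 1: "(transpose_mat M * pairing_gram f 1) $$ (i,k) = pairing_gram f 1 $$ (i,k)" if "k < N" for k
      using that ij N carrier_matD[OF pairing_gram_carrier[of 1]]
      by (auto simp: M_def scalar_prod_def if_distrib[of "\<lambda>y. y * _"] cong: if_cong)
    have "(transpose_mat M * pairing_gram f 1 * M) $$ (i,j)
        = (\<Sum>k = 0..<N. (transpose_mat M * pairing_gram f 1) $$ (i,k) * M $$ (k,j))"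
      using ij M by (auto simp: scalar_prod_def carrier_matD[OF pairing_gram_carrier] intro!: sum.cong)
    also have "\<dots> = (\<Sum>k = 0..<N. if k = j then pairing_gram f 1 $$ (i,k) else 0)"
      using 1 ij by (intro sum.cong) (auto simp: M_def)
    also have "\<dots> = pairing_gram f 1 $$ (i,j)" using ij N by simp
    also have "\<dots> = lam (monom 1 (i + j))" using ij N by (simp add: pairing_gram_eq mult_monom)
    also have "\<dots> = 0"
    proof -
      have "i + j < N" "i + j \<noteq> N - 1" using ij N by auto
      then show ?thesis by (simp add: lam_def mod_f_id degree_monom_eq)
    qed
    finally show "(transpose_mat M * pairing_gram f 1 * M) $$ (i,j) = 0\<^sub>m m m $$ (i,j)" using ij by simp
  qed (use M in auto)
  moreover have "dim_row (pairing_gram f 1) = N" "N div 2 = m" "even N"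
    using N by (auto simp: pairing_gram_eq)
  moreover have "det (pairing_gram f 1) \<noteq> 0"
    using pairing_gram_1_invertible invertible_mat_iff_det[of "pairing_gram f 1" N] by simp
  ultimately show ?thesis
    using M inj by (auto simp: split_form_def Let_def pairing_gram_symmetric)
qed

end

section \<open>Orbits and classes\<close>

text \<open>No dimension assumption on \<open>A\<close>: the class \<open>PO_conj B `` {T}\<close> also contains matrices with too many columns.\<close>

lemma mult_mat_assoc_any:
  fixes A :: "'a::field mat"
  assumes "g \<in> carrier_mat N N" "h \<in> carrier_mat N N"
  shows "A * (g * h) = (A * g) * h"
proof -
  define A' where "A' = mat (dim_row A) N (\<lambda>(i,j). row A i $ j)"
  have A': "A * k = A' * k" if "k \<in> carrier_mat N N" for k
    using that by (intro eq_matI) (auto simp: A'_def scalar_prod_def intro!: sum.cong)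
  have "A' * (g * h) = A' * g * h"
    using assms by (intro assoc_mult_mat[symmetric, of _ "dim_row A" N _ N _ N]) (auto simp: A'_def)
  then show ?thesis using assms A' by simp
qed

lemma similitude_mult:
  assumes B: "B \<in> carrier_mat N N" and g: "similitude B g" and h: "similitude B h"
  shows "similitude B (g * h)"
proof -
  have gc: "g \<in> carrier_mat N N" "invertible_mat g" and hc: "h \<in> carrier_mat N N" "invertible_mat h"
    using B g h by (auto simp: similitude_def)
  obtain c where c: "c \<noteq> 0" "transpose_mat g * B * g = c \<cdot>\<^sub>m B" using g by (auto simp: similitude_def)
  obtain d where d: "d \<noteq> 0" "transpose_mat h * B * h = d \<cdot>\<^sub>m B" using h by (auto simp: similitude_def)
  have "transpose_mat (g * h) * B * (g * h) = transpose_mat h * (c \<cdot>\<^sub>m B) * h"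
    using congruence_mult[OF gc(1) hc(1) B] c by simp
  also have "\<dots> = c \<cdot>\<^sub>m (transpose_mat h * B * h)"
    using hc B by (simp add: mult_smult_distrib[of _ N N _ N] mult_smult_assoc_mat[of _ N N _ N])
  also have "\<dots> = (c * d) \<cdot>\<^sub>m B" using B by (simp add: d) (intro eq_matI, auto)
  finally show ?thesis
    using gc hc B c d invertible_mat_mult[OF gc(1) hc(1)] by (auto simp: similitude_def intro!: exI[of _ "c * d"])
qed

lemma similitude_inverse:
  assumes B: "B \<in> carrier_mat N N" and g: "similitude B g"
    and g': "g' \<in> carrier_mat N N" "g * g' = 1\<^sub>m N" "g' * g = 1\<^sub>m N"
  shows "similitude B g'"
proof -
  have gc: "g \<in> carrier_mat N N" using B g by (auto simp: similitude_def)
  obtain c where c: "c \<noteq> 0" "transpose_mat g * B * g = c \<cdot>\<^sub>m B" using g by (auto simp: similitude_def)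
  have "B = transpose_mat (g * g') * B * (g * g')" using B g' by simp
  also have "\<dots> = transpose_mat g' * (c \<cdot>\<^sub>m B) * g'"
    using congruence_mult[OF gc g'(1) B] c by simp
  also have "\<dots> = c \<cdot>\<^sub>m (transpose_mat g' * B * g')"
    using g' B by (simp add: mult_smult_distrib[of _ N N _ N] mult_smult_assoc_mat[of _ N N _ N])
  finally have "inverse c \<cdot>\<^sub>m B = inverse c \<cdot>\<^sub>m (c \<cdot>\<^sub>m (transpose_mat g' * B * g'))" by simp
  also have "\<dots> = transpose_mat g' * B * g'" using c(1) g' B by (intro eq_matI) auto
  finally show ?thesis
    using g' B c invertible_matI[OF g'(1) gc g'(3)] by (auto simp: similitude_def intro!: exI[of _ "inverse c"])
qed

text \<open>The classes are images in the type of all matrices. Transitivity is therefore proved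
  with its last matrix unrestricted, and symmetry only for the given square pair.\<close>

lemma PO_conj_class_eq_iff:
  assumes B: "B \<in> carrier_mat N N" and T: "T \<in> carrier_mat N N" and T': "T' \<in> carrier_mat N N"
  shows "PO_conj B `` {T} = PO_conj B `` {T'} \<longleftrightarrow> (T, T') \<in> PO_conj B"
proof
  have "similitude B (1\<^sub>m N)"
    using B by (auto simp: similitude_def intro!: exI[of _ 1] invertible_matI[of _ N "1\<^sub>m N"])
  then have "(T', T') \<in> PO_conj B" using T' by (auto simp: PO_conj_def intro!: exI[of _ "1\<^sub>m N"])
  then show "(T, T') \<in> PO_conj B" if "PO_conj B `` {T} = PO_conj B `` {T'}" using that by blast
next
  have trans: "(X, Z) \<in> PO_conj B"
    if XY: "(X, Y) \<in> PO_conj B" and YZ: "(Y, Z) \<in> PO_conj B"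
      and carr: "X \<in> carrier_mat N N" "Y \<in> carrier_mat N N" for X Y Z
  proof -
    obtain g where g: "similitude B g" "Y * g = g * X" using XY by (auto simp: PO_conj_def)
    obtain h where h: "similitude B h" "Z * h = h * Y" using YZ by (auto simp: PO_conj_def)
    have c: "g \<in> carrier_mat N N" "h \<in> carrier_mat N N" using g h B by (auto simp: similitude_def)
    have "Z * (h * g) = h * Y * g" unfolding mult_mat_assoc_any[OF c(2,1)] h(2) ..
    also have "\<dots> = h * (Y * g)" using c carr by (simp add: assoc_mult_mat[of _ N N _ N _ N])
    also have "\<dots> = h * g * X" unfolding g(2) using c carr by (simp add: assoc_mult_mat[of _ N N _ N _ N])
    finally show ?thesis using similitude_mult[OF B h(1) g(1)] by (auto simp: PO_conj_def)
  qed
  assume TT': "(T, T') \<in> PO_conj B"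
  then obtain g where g: "similitude B g" "T' * g = g * T" by (auto simp: PO_conj_def)
  have gc: "g \<in> carrier_mat N N" "invertible_mat g" using g B by (auto simp: similitude_def)
  obtain g' where g': "g' \<in> carrier_mat N N" "g * g' = 1\<^sub>m N" "g' * g = 1\<^sub>m N"
    by (rule invertible_matE[OF gc])
  have "T * g' = (g' * g) * T * g'" using T g' by simp
  also have "\<dots> = g' * (T' * g) * g'" unfolding g(2) assoc_mult_mat[OF g'(1) gc(1) T] ..
  also have "\<dots> = g' * T' * (g * g')" using T' g'(1) gc by (simp add: assoc_mult_mat[of _ N N _ N _ N])
  also have "\<dots> = g' * T'" using T' g' by simp
  finally have "(T', T) \<in> PO_conj B"
    using similitude_inverse[OF B g(1) g'] by (auto simp: PO_conj_def)
  then show "PO_conj B `` {T} = PO_conj B `` {T'}" using TT' trans T T' by blast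
qed

lemma ksq_class_eq_iff:
  fixes f :: "'a::field poly"
  assumes a: "L_unit f a" and b: "L_unit f b"
  shows "ksq_class_rel f `` {a} = ksq_class_rel f `` {b} \<longleftrightarrow> (a, b) \<in> ksq_class_rel f"
proof -
  have cong: "(z * x) mod f = (z * y) mod f" if "x mod f = y mod f" for x y z
    using that by (metis mod_mult_right_eq)
  have unit1: "L_unit f 1" by (auto simp: L_unit_def intro: exI[of _ 1])
  have unit_mult: "L_unit f (u * v)" if uv: "L_unit f u" "L_unit f v" for u v
  proof -
    obtain u' v' where *: "(u * u') mod f = 1 mod f" "(v * v') mod f = 1 mod f" using uv by (auto simp: L_unit_def)
    have "(u * v * (u' * v')) mod f = ((u * u') * (v * v')) mod f" by (simp add: ac_simps)
    also have "\<dots> = 1 mod f" using cong[OF *(2), of "u * u'"] *(1) by simp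
    finally show ?thesis by (auto simp: L_unit_def)
  qed
  have refl: "(x, x) \<in> ksq_class_rel f" if "L_unit f x" for x
    using that unit1 unfolding ksq_class_rel_def by (auto intro!: exI[of _ 1])
  have sym: "(y, x) \<in> ksq_class_rel f" if xy: "(x, y) \<in> ksq_class_rel f" for x y
  proof -
    obtain c u where c: "c \<noteq> 0" and u: "L_unit f u" and eq: "x mod f = Polynomial.smult c (y * u * u) mod f"
      and units: "L_unit f x" "L_unit f y"
      using xy by (auto simp: ksq_class_rel_def)
    obtain w where w: "(u * w) mod f = 1 mod f" using u by (auto simp: L_unit_def)
    have "L_unit f w" using w by (auto simp: L_unit_def mult.commute)
    have "Polynomial.smult (inverse c) (x * w * w) mod f = (Polynomial.smult (inverse c) (w * w) * x) mod f"
      by (simp add: ac_simps)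
    also have "\<dots> = (Polynomial.smult (inverse c) (w * w) * Polynomial.smult c (y * u * u)) mod f"
      by (rule cong[OF eq])
    also have "\<dots> = (y * (u * w) * (u * w)) mod f" using c by (simp add: ac_simps)
    also have "\<dots> = (y * (u * w) * 1) mod f" by (rule cong[OF w])
    also have "\<dots> = (y * (u * w)) mod f" by simp
    also have "\<dots> = (y * 1) mod f" by (rule cong[OF w])
    finally have "y mod f = Polynomial.smult (inverse c) (x * w * w) mod f" by simp
    then show ?thesis using c \<open>L_unit f w\<close> units unfolding ksq_class_rel_def
      by (auto intro!: exI[of _ "inverse c"] exI[of _ w])
  qed
  have trans: "(x, z) \<in> ksq_class_rel f"
    if xy: "(x, y) \<in> ksq_class_rel f" and yz: "(y, z) \<in> ksq_class_rel f" for x y z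
  proof -
    obtain c u where c: "c \<noteq> 0" and u: "L_unit f u" and eq: "x mod f = Polynomial.smult c (y * u * u) mod f"
      and x: "L_unit f x" using xy by (auto simp: ksq_class_rel_def)
    obtain d v where d: "d \<noteq> 0" and v: "L_unit f v" and eq': "y mod f = Polynomial.smult d (z * v * v) mod f"
      and z: "L_unit f z" using yz by (auto simp: ksq_class_rel_def)
    have "x mod f = (Polynomial.smult c (u * u) * y) mod f" unfolding eq by (simp add: ac_simps)
    also have "\<dots> = (Polynomial.smult c (u * u) * Polynomial.smult d (z * v * v)) mod f" by (rule cong[OF eq'])
    also have "\<dots> = Polynomial.smult (c * d) (z * (u * v) * (u * v)) mod f" by (simp add: ac_simps)
    finally show ?thesis using c d x z unit_mult[OF u v] unfolding ksq_class_rel_def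
      by (auto intro!: exI[of _ "c * d"] exI[of _ "u * v"])
  qed
  show ?thesis using refl[OF b] sym trans by blast
qed

text \<open>A relation that is total on both sides and matches equality of classes induces a
  bijection of quotients. The relations r and s enter only through equality of classes, so classes
  may reach outside X and Y.\<close>

lemma quotient_bij_betw:
  assumes X: "\<And>x. x \<in> X \<Longrightarrow> \<exists>y\<in>Y. R x y" and Y: "\<And>y. y \<in> Y \<Longrightarrow> \<exists>x\<in>X. R x y"
    and compat: "\<And>x x' y y'. x \<in> X \<Longrightarrow> x' \<in> X \<Longrightarrow> y \<in> Y \<Longrightarrow> y' \<in> Y \<Longrightarrow> R x y \<Longrightarrow> R x' y' \<Longrightarrow>
      r `` {x} = r `` {x'} \<longleftrightarrow> s `` {y} = s `` {y'}"
  shows "\<exists>\<phi>. bij_betw \<phi> (X // r) (Y // s) \<and> (\<forall>x\<in>X. \<forall>y\<in>Y. R x y \<longrightarrow> \<phi> (r `` {x}) = s `` {y})"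
proof -
  \<comment> \<open>Any partner of any representative will do; \<open>compat\<close> makes the
    resulting class independent of the choice.\<close>
  define \<phi> where "\<phi> q = s `` {SOME y. y \<in> Y \<and> (\<exists>x\<in>X. q = r `` {x} \<and> R x y)}" for q
  have \<phi>: "\<phi> (r `` {x}) = s `` {y}" if xy: "x \<in> X" "y \<in> Y" "R x y" for x y
  proof -
    define y' where "y' = (SOME y'. y' \<in> Y \<and> (\<exists>x'\<in>X. r `` {x} = r `` {x'} \<and> R x' y'))"
    have "y' \<in> Y \<and> (\<exists>x'\<in>X. r `` {x} = r `` {x'} \<and> R x' y')"
      unfolding y'_def by (rule someI_ex) (use xy in blast)
    then obtain x' where "y' \<in> Y" "x' \<in> X" "r `` {x} = r `` {x'}" "R x' y'" by blast
    then have "s `` {y'} = s `` {y}" using compat[of x x' y y'] xy by simp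
    then show ?thesis by (simp add: \<phi>_def y'_def)
  qed
  have "bij_betw \<phi> (X // r) (Y // s)"
  proof (rule bij_betw_imageI)
    show "inj_on \<phi> (X // r)"
    proof (rule inj_onI)
      fix q q' assume "q \<in> X // r" "q' \<in> X // r" and eq: "\<phi> q = \<phi> q'"
      then obtain x x' where x: "x \<in> X" "q = r `` {x}" "x' \<in> X" "q' = r `` {x'}" by (auto elim!: quotientE)
      obtain y y' where y: "y \<in> Y" "R x y" "y' \<in> Y" "R x' y'" using x X by meson
      have "s `` {y} = s `` {y'}" using eq \<phi>[OF x(1) y(1,2)] \<phi>[OF x(3) y(3,4)] x by simp
      then show "q = q'" using compat[OF x(1,3) y(1,3,2,4)] x by simp
    qed
    show "\<phi> ` (X // r) = Y // s"
    proof (intro equalityI subsetI)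
      fix z assume "z \<in> \<phi> ` (X // r)"
      then obtain x where x: "x \<in> X" "z = \<phi> (r `` {x})" by (auto elim!: quotientE)
      obtain y where "y \<in> Y" "R x y" using X x by blast
      then show "z \<in> Y // s" using x \<phi> by (simp add: quotientI)
    next
      fix z assume "z \<in> Y // s"
      then obtain y where y: "y \<in> Y" "z = s `` {y}" by (auto elim!: quotientE)
      obtain x where "x \<in> X" "R x y" using Y y by blast
      then show "z \<in> \<phi> ` (X // r)" using y \<phi> by (intro image_eqI[of _ _ "r `` {x}"]) (simp_all add: quotientI)
    qed
  qed
  then show ?thesis using \<phi> by blast
qed

section \<open>The correspondence between operators and classes\<close>

context separable_quotient
begin

lemma correspondsE:
  assumes "B \<in> carrier_mat N N" "corresponds B f T a"
  obtains P P' where "P \<in> carrier_mat N N" "P' \<in> carrier_mat N N" "P * P' = 1\<^sub>m N" "P' * P = 1\<^sub>m N"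
    "invertible_mat P" "T \<in> carrier_mat N N" "T * P = P * L_mult_mat f [:0,1:]"
    "transpose_mat P * B * P = pairing_gram f a"
proof -
  obtain P where P: "P \<in> carrier_mat N N" "invertible_mat P" "T * P = P * L_mult_mat f [:0,1:]"
    "transpose_mat P * B * P = pairing_gram f a" "T \<in> carrier_mat N N"
    using assms by (auto simp: corresponds_def deg)
  obtain P' where "P' \<in> carrier_mat N N" "P * P' = 1\<^sub>m N" "P' * P = 1\<^sub>m N"
    by (rule invertible_matE[OF P(1,2)])
  with P that show thesis by blast
qed

lemma corresponds_in_V_f:
  assumes B: "B \<in> carrier_mat N N" and corr: "corresponds B f T a"
  shows "T \<in> V_f B f"
proof -
  let ?C = "L_mult_mat f [:0,1:]"
  obtain P P' where P: "P \<in> carrier_mat N N" "P' \<in> carrier_mat N N" "P * P' = 1\<^sub>m N" "P' * P = 1\<^sub>m N"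
    "invertible_mat P" and T: "T \<in> carrier_mat N N" and TP: "T * P = P * ?C"
    and G: "transpose_mat P * B * P = pairing_gram f a"
    by (rule correspondsE[OF B corr])
  have "T = (T * P) * P'" using P T by (simp add: assoc_mult_mat[of _ N N _ N _ N])
  then have "T = P * ?C * P'" by (simp add: TP)
  then have "similar_mat_wit T ?C P P'" using P T unfolding similar_mat_wit_def by (simp add: Let_def)
  then have "char_poly T = f"
    using char_poly_similar[of T ?C] char_poly_L_mult_mat_X by (auto simp: similar_mat_def)
  \<comment> \<open>Pulled back along P, this is the self-adjointness of multiplication by \<beta>
    for the pairing of a.\<close>
  moreover have "transpose_mat T * B = B * T"
  proof (rule congruence_cancel[OF P(1,5)])
    have "transpose_mat P * (transpose_mat T * B) * P = transpose_mat (T * P) * B * P"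
      using P(1) T B by (simp add: transpose_mult[of _ N N _ N] assoc_mult_mat[of _ N N _ N _ N])
    also have "\<dots> = transpose_mat ?C * (transpose_mat P * B * P)"
      unfolding TP using P(1) B by (simp add: transpose_mult[of _ N N _ N] assoc_mult_mat[of _ N N _ N _ N])
    also have "\<dots> = (transpose_mat P * B * P) * ?C"
      unfolding G by (simp add: L_mult_mat_transpose_mult pairing_gram_mult)
    also have "\<dots> = transpose_mat P * B * (T * P)"
      unfolding TP using P(1) B by (simp add: assoc_mult_mat[of _ N N _ N _ N])
    also have "\<dots> = transpose_mat P * (B * T) * P"
      using P(1) B T by (simp add: assoc_mult_mat[of _ N N _ N _ N])
    finally show "transpose_mat P * (transpose_mat T * B) * P = transpose_mat P * (B * T) * P" .
  qed (use B T in auto)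
  ultimately show ?thesis using T B by (simp add: V_f_def self_adjoint_def)
qed

lemma corresponds_imp_unit:
  assumes B: "B \<in> carrier_mat N N" "det B \<noteq> 0" and corr: "corresponds B f T a"
  shows "L_unit f a"
proof -
  obtain P P' where P: "P \<in> carrier_mat N N" "P' \<in> carrier_mat N N" "P * P' = 1\<^sub>m N" "P' * P = 1\<^sub>m N"
    "invertible_mat P" and G: "transpose_mat P * B * P = pairing_gram f a"
    by (rule correspondsE[OF B(1) corr])
  have "det (pairing_gram f a) \<noteq> 0"
    unfolding G[symmetric] det_congruence[OF P(1) B(1)] using P(1,5) B by (simp add: invertible_mat_iff_det)
  then show ?thesis using pairing_gram_invertible_iff invertible_mat_iff_det[OF pairing_gram_carrier] by blast
qed

lemma corresponds_imp_split:
  assumes B: "B \<in> carrier_mat N N" "split_form B" and corr: "corresponds B f T a"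
  shows "split_form (pairing_gram f a)"
proof -
  obtain P P' where P: "P \<in> carrier_mat N N" "P' \<in> carrier_mat N N" "P * P' = 1\<^sub>m N" "P' * P = 1\<^sub>m N"
    "invertible_mat P" and G: "transpose_mat P * B * P = pairing_gram f a"
    by (rule correspondsE[OF B(1) corr])
  show ?thesis using split_form_congruence[OF B P(1,5)] by (simp add: G)
qed

text \<open>\<open>\<langle>,\<rangle>\<^sub>1\<close> is itself split, and congruent forms have determinants differing by a square.\<close>

lemma split_imp_norm_trivial:
  assumes two: "(2::'a) \<noteq> 0" and a: "split_form (pairing_gram f a)"
  shows "norm_trivial f a"
proof -
  have "even N" using a carrier_matD[OF pairing_gram_carrier] by (auto simp: split_form_def Let_def)
  then obtain m where "N = 2 * m" by auto
  then have one: "split_form (pairing_gram f 1)" by (rule pairing_gram_1_split)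
  obtain P where P: "P \<in> carrier_mat N N" "transpose_mat P * pairing_gram f 1 * P = pairing_gram f a"
    using split_form_congruent[OF two pairing_gram_carrier one pairing_gram_carrier a] by blast
  have nz: "det (pairing_gram f 1) \<noteq> 0" using one by (auto simp: split_form_def Let_def)
  have "det (pairing_gram f 1) * L_norm f a = det P ^ 2 * det (pairing_gram f 1)"
    using det_congruence[OF P(1) pairing_gram_carrier, of 1] by (simp add: P(2) det_pairing_gram[of a])
  then have "L_norm f a = det P ^ 2" using nz by simp
  then show ?thesis by (auto simp: norm_trivial_def is_square_def)
qed

text \<open>Transport multiplication by \<beta> along an isometry from L to U.\<close>

lemma split_imp_exists_corresponds:
  assumes two: "(2::'a) \<noteq> 0" and B: "B \<in> carrier_mat N N" "split_form B"
    and a: "split_form (pairing_gram f a)"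
  shows "\<exists>T. corresponds B f T a"
proof -
  let ?C = "L_mult_mat f [:0,1:]"
  obtain P where P: "P \<in> carrier_mat N N" "invertible_mat P" "transpose_mat P * B * P = pairing_gram f a"
    using split_form_congruent[OF two B pairing_gram_carrier a] by blast
  obtain P' where P': "P' \<in> carrier_mat N N" "P' * P = 1\<^sub>m N" using invertible_matE[OF P(1,2)] by metis
  have "(P * ?C * P') * P = P * ?C"
    using assoc_mult_mat[OF mult_carrier_mat[OF P(1) L_mult_mat_carrier] P'(1) P(1)] P'(2)
      right_mult_one_mat[OF mult_carrier_mat[OF P(1) L_mult_mat_carrier]] by simp
  then have "corresponds B f (P * ?C * P') a"
    using P P' B by (auto simp: corresponds_def deg intro!: bexI[of _ P])
  then show ?thesis by blast
qed

lemma V_f_imp_exists_corresponds: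
  assumes B: "B \<in> carrier_mat N N" and T: "T \<in> V_f B f"
  shows "\<exists>a. corresponds B f T a"
proof -
  let ?C = "L_mult_mat f [:0,1:]"
  have Tc: "T \<in> carrier_mat N N" and sa: "transpose_mat T * B = B * T" and cp: "char_poly T = f"
    using T B by (auto simp: V_f_def self_adjoint_def)
  note carr [simp] = poly_mat_carrier[OF Tc]
  obtain v where v: "v \<in> carrier_vec N" and ann: "\<And>h. poly_mat h T *\<^sub>v v = 0\<^sub>v N \<longleftrightarrow> f dvd h"
    using exists_cyclic_vector[OF Tc] sep unfolding cp by blast
  \<comment> \<open>The map sending g to g(T) v, with columns \<open>T^j v\<close>; it is well
    defined on residues because f kills v.\<close>
  define P where "P = mat N N (\<lambda>(i,j). (poly_mat (monom 1 j) T *\<^sub>v v) $ i)"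
  have P: "P \<in> carrier_mat N N" by (simp add: P_def)
  have Pv: "P *\<^sub>v cvec g = poly_mat g T *\<^sub>v v" for g
  proof -
    have "poly_mat g T *\<^sub>v v = poly_mat (g div f * f + g mod f) T *\<^sub>v v" by simp
    also have "\<dots> = poly_mat (g div f * f) T *\<^sub>v v + poly_mat (g mod f) T *\<^sub>v v"
      by (rule poly_mat_add_vec[OF Tc v])
    also have "poly_mat (g div f * f) T *\<^sub>v v = 0\<^sub>v N" using ann by simp
    also have "0\<^sub>v N + poly_mat (g mod f) T *\<^sub>v v = poly_mat (g mod f) T *\<^sub>v v"
      using v by (intro left_zero_vec mult_mat_vec_carrier[of _ N N]) auto
    also have "\<dots> = P *\<^sub>v cvec g"
    proof (rule eq_vecI)
      fix i assume "i < dim_vec (P *\<^sub>v cvec g)"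
      then have i: "i < N" using P by simp
      have "(poly_mat (g mod f) T *\<^sub>v v) $ i
          = (\<Sum>j<N. coeff (g mod f) j * (poly_mat (monom 1 j) T *\<^sub>v v) $ i)"
        using i v
        by (intro linear_functional_expand[of "\<lambda>g. (poly_mat g T *\<^sub>v v) $ i"] degree_mod_f)
          (simp_all add: poly_mat_add_vec[OF Tc] poly_mat_smult[OF Tc] smult_mat_mult_vec[of _ N N]
            carrier_matD[OF carr])
      also have "\<dots> = (P *\<^sub>v cvec g) $ i"
        using i by (auto simp: P_def scalar_prod_def atLeast0LessThan mult.commute intro!: sum.cong)
      finally show "(poly_mat (g mod f) T *\<^sub>v v) $ i = (P *\<^sub>v cvec g) $ i" .
    qed (simp add: carrier_matD[OF carr] carrier_matD[OF P])
    finally show ?thesis by simp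
  qed
  have TP: "T * P = P * ?C"
  proof (rule mat_eq_cvec[of _ N])
    fix g
    have "T * P *\<^sub>v cvec g = T *\<^sub>v (poly_mat g T *\<^sub>v v)"
      using Tc P by (simp add: assoc_mult_mat_vec[of _ N N _ N] Pv)
    also have "\<dots> = poly_mat ([:0,1:] * g) T *\<^sub>v v"
      unfolding poly_mat_mult_vec[OF Tc v] poly_mat_X[OF Tc] ..
    also have "\<dots> = P * ?C *\<^sub>v cvec g"
      using P by (simp add: assoc_mult_mat_vec[of _ N N _ N] L_mult_mat_mult_vec Pv)
    finally show "T * P *\<^sub>v cvec g = P * ?C *\<^sub>v cvec g" .
  qed (use Tc P in \<open>auto intro: mult_carrier_mat[of _ N N]\<close>)
  \<comment> \<open>Only multiples of f kill the cyclic vector, so P is injective.\<close>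
  have inv: "invertible_mat P"
    unfolding invertible_mat_iff_kernel[OF P]
  proof (intro ballI impI)
    fix w assume w: "w \<in> carrier_vec N" "P *\<^sub>v w = 0\<^sub>v N"
    obtain g where g: "cvec g = w" using cvec_surj[OF w(1)] by blast
    then have "poly_mat g T *\<^sub>v v = 0\<^sub>v N" using w(2) Pv[of g] by simp
    then have "f dvd g" using ann by blast
    then have "g mod f = 0" by simp
    then show "w = 0\<^sub>v N" using g cvec_eq_iff[of g 0] by simp
  qed
  \<comment> \<open>The form of U pulled back to L: T being self-adjoint makes \<beta> self-adjoint
    for G, so G is the pairing of some a.\<close>
  define G where "G = transpose_mat P * B * P"
  have G: "G \<in> carrier_mat N N" using P B by (simp add: G_def)
  have "transpose_mat ?C * G = transpose_mat (T * P) * B * P"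
    unfolding TP G_def using P B by (simp add: transpose_mult[of _ N N _ N] assoc_mult_mat[of _ N N _ N _ N])
  also have "\<dots> = transpose_mat P * (transpose_mat T * B) * P"
    using P Tc B by (simp add: transpose_mult[of _ N N _ N] assoc_mult_mat[of _ N N _ N _ N])
  also have "\<dots> = transpose_mat P * B * (T * P)"
    unfolding sa using P Tc B by (simp add: assoc_mult_mat[of _ N N _ N _ N])
  also have "\<dots> = G * ?C"
    unfolding TP G_def using P B by (simp add: assoc_mult_mat[of _ N N _ N _ N])
  finally obtain a where "G = pairing_gram f a" using exists_pairing_gram[OF G] by blast
  then show ?thesis using Tc P B inv TP by (auto simp: corresponds_def deg G_def intro!: exI[of _ a] bexI[of _ P])
qed

text \<open>The unit u records how the similitude acts between the two copies of L, and its
  multiplier c accounts for the scalars from k.\<close>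

lemma PO_conj_iff_ksq_class_rel:
  assumes B: "B \<in> carrier_mat N N"
    and units: "L_unit f a1" "L_unit f a2"
    and corr: "corresponds B f T1 a1" "corresponds B f T2 a2"
  shows "(T1, T2) \<in> PO_conj B \<longleftrightarrow> (a1, a2) \<in> ksq_class_rel f"
proof -
  let ?C = "L_mult_mat f [:0,1:]"
  note assoc = assoc_mult_mat[of _ N N _ N _ N]
  obtain P P' where P: "P \<in> carrier_mat N N" "P' \<in> carrier_mat N N" "P * P' = 1\<^sub>m N" "P' * P = 1\<^sub>m N"
    "invertible_mat P" and T1: "T1 \<in> carrier_mat N N" and T1P: "T1 * P = P * ?C"
    and GP: "transpose_mat P * B * P = pairing_gram f a1"
    by (rule correspondsE[OF B corr(1)])
  obtain Q Q' where Q: "Q \<in> carrier_mat N N" "Q' \<in> carrier_mat N N" "Q * Q' = 1\<^sub>m N" "Q' * Q = 1\<^sub>m N"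
    "invertible_mat Q" and T2: "T2 \<in> carrier_mat N N" and T2Q: "T2 * Q = Q * ?C"
    and GQ: "transpose_mat Q * B * Q = pairing_gram f a2"
    by (rule correspondsE[OF B corr(2)])
  have invP': "invertible_mat P'" by (rule invertible_matI[OF P(2,1,4)])
  have invQ': "invertible_mat Q'" by (rule invertible_matI[OF Q(2,1,4)])
  have PT1: "P' * T1 = ?C * P'"
  proof -
    have "P' * T1 = P' * (T1 * P) * P'" using P T1 by (simp add: assoc)
    also have "\<dots> = ?C * P'"
      unfolding T1P mult_mat_reassoc[OF P(4,2,1) L_mult_mat_carrier] left_mult_one_mat[OF L_mult_mat_carrier] ..
    finally show ?thesis .
  qed
  have QT2: "Q' * T2 = ?C * Q'"
  proof -
    have "Q' * T2 = Q' * (T2 * Q) * Q'" using Q T2 by (simp add: assoc)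
    also have "\<dots> = ?C * Q'"
      unfolding T2Q mult_mat_reassoc[OF Q(4,2,1) L_mult_mat_carrier] left_mult_one_mat[OF L_mult_mat_carrier] ..
    finally show ?thesis .
  qed
  show ?thesis
  proof
    assume "(T1, T2) \<in> PO_conj B"
    then obtain g where "similitude B g" and gT: "T2 * g = g * T1" by (auto simp: PO_conj_def)
    then obtain c where g: "g \<in> carrier_mat N N" "invertible_mat g"
      and c: "c \<noteq> 0" "transpose_mat g * B * g = c \<cdot>\<^sub>m B"
      using B by (auto simp: similitude_def)
    \<comment> \<open>The similitude g read as an operator on L; it commutes with \<beta>, hence is
      multiplication by some u.\<close>
    define h where "h = Q' * (g * P)"
    have h: "h \<in> carrier_mat N N" using Q P g by (simp add: h_def)
    have "h * ?C = Q' * (g * (P * ?C))" unfolding h_def using Q P g by (simp add: assoc)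
    also have "\<dots> = Q' * ((g * T1) * P)" unfolding T1P[symmetric] using g T1 P by (simp add: assoc)
    also have "\<dots> = (Q' * T2) * (g * P)" unfolding gT[symmetric] using Q T2 P g by (simp add: assoc)
    also have "\<dots> = ?C * h" unfolding QT2 h_def using Q P g by (simp add: assoc)
    finally obtain u where u: "h = L_mult_mat f u" using commutant_L_mult_mat_X[OF h] by blast
    have "invertible_mat h"
      unfolding h_def using P Q g invQ' by (intro invertible_mat_mult[of _ N] mult_carrier_mat[of _ N N]) auto
    then have uu: "L_unit f u" by (simp add: u L_mult_mat_invertible_iff)
    have Qh: "Q * h = g * P" unfolding h_def using Q P g by (simp add: mult_mat_reassoc[OF Q(3)])
    \<comment> \<open>The form B is pulled back along \<open>Q * h = g * P\<close> in two ways: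
      through Q it is the pairing of a2 u^2, through g that of c a1.\<close>
    have "pairing_gram f (a2 * u * u) = transpose_mat h * (transpose_mat Q * B * Q) * h"
      by (simp add: GQ u pairing_gram_congruence)
    also have "\<dots> = transpose_mat (g * P) * B * (g * P)"
      unfolding congruence_mult[OF Q(1) h B, symmetric] Qh ..
    also have "\<dots> = transpose_mat P * (c \<cdot>\<^sub>m B) * P"
      unfolding congruence_mult[OF g(1) P(1) B] c(2) ..
    also have "\<dots> = c \<cdot>\<^sub>m (transpose_mat P * B * P)"
      using P B by (simp add: mult_smult_distrib[of _ N N _ N] mult_smult_assoc_mat[of _ N N _ N])
    also have "\<dots> = pairing_gram f (Polynomial.smult c a1)"
      unfolding GP pairing_gram_smult ..
    finally have "(a2 * u * u) mod f = Polynomial.smult c a1 mod f" by (simp add: pairing_gram_eq_iff)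
    then have "Polynomial.smult (inverse c) (a2 * u * u) mod f = a1 mod f"
      using c(1) by (simp add: mod_smult_left)
    then show "(a1, a2) \<in> ksq_class_rel f"
      using units uu c(1) unfolding ksq_class_rel_def by (auto intro!: exI[of _ "inverse c"] exI[of _ u])
  next
    assume "(a1, a2) \<in> ksq_class_rel f"
    then obtain c u where c: "c \<noteq> 0" and u: "L_unit f u"
      and eq: "a1 mod f = Polynomial.smult c (a2 * u * u) mod f"
      by (auto simp: ksq_class_rel_def)
    let ?M = "L_mult_mat f u"
    \<comment> \<open>Reverses the passage from g to h: leave U by the inverse of P, multiply by u,
      return by Q. As a1 is c a2 u^2, the multiplier of g is \<open>inverse c\<close>.\<close>
    define g where "g = Q * (?M * P')"
    have MP: "?M * P' \<in> carrier_mat N N" using P(2) by (auto intro: mult_carrier_mat[of _ N N])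
    have g: "g \<in> carrier_mat N N" using Q MP by (simp add: g_def)
    have inv: "invertible_mat g"
      unfolding g_def using Q P u invP' MP
      by (intro invertible_mat_mult[of _ N]) (auto simp: L_mult_mat_invertible_iff)
    have "T2 * g = (Q * ?C) * (?M * P')" unfolding g_def using T2 Q MP by (simp only: mult_mat_reassoc[OF T2Q])
    also have "\<dots> = Q * ((?C * ?M) * P')"
      unfolding assoc[OF Q(1) L_mult_mat_carrier MP] assoc[OF L_mult_mat_carrier L_mult_mat_carrier P(2)] ..
    also have "?C * ?M = ?M * ?C" unfolding L_mult_mat_mult by (simp only: mult.commute)
    also have "Q * ((?M * ?C) * P') = Q * (?M * (P' * T1))"
      unfolding PT1 assoc[OF L_mult_mat_carrier L_mult_mat_carrier P(2)] ..
    also have "\<dots> = g * T1"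
      unfolding g_def assoc[OF Q(1) MP T1] assoc[OF L_mult_mat_carrier P(2) T1] ..
    finally have gT: "T2 * g = g * T1" .
    have eq': "(a2 * u * u) mod f = Polynomial.smult (inverse c) a1 mod f"
      using c eq by (simp add: mod_smult_left)
    have "transpose_mat g * B * g = transpose_mat P' * pairing_gram f (a2 * u * u) * P'"
      unfolding g_def congruence_mult[OF Q(1) MP B] GQ
        congruence_mult[OF L_mult_mat_carrier P(2) pairing_gram_carrier] pairing_gram_congruence ..
    also have "pairing_gram f (a2 * u * u) = inverse c \<cdot>\<^sub>m (transpose_mat P * B * P)"
      unfolding GP pairing_gram_smult[symmetric] pairing_gram_eq_iff by (rule eq')
    also have "transpose_mat P' * (inverse c \<cdot>\<^sub>m (transpose_mat P * B * P)) * P'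
        = inverse c \<cdot>\<^sub>m (transpose_mat P' * (transpose_mat P * B * P) * P')"
      using P B by (simp add: mult_smult_distrib[of _ N N _ N] mult_smult_assoc_mat[of _ N N _ N])
    also have "transpose_mat P' * (transpose_mat P * B * P) * P' = B"
      unfolding congruence_mult[OF P(1,2) B, symmetric] P(3) using B by simp
    finally have "similitude B g"
      using g inv B c by (auto simp: similitude_def intro!: exI[of _ "inverse c"])
    then show "(T1, T2) \<in> PO_conj B" using gT by (auto simp: PO_conj_def)
  qed
qed

end

theorem theorem2p6:
  fixes B :: "'k::field mat" and f :: "'k poly" and n :: nat
  assumes char: "(2::'k) \<noteq> 0"
    and B: "B \<in> carrier_mat (2*n+2) (2*n+2)"
    and U_split: "split_form B" and U_disc: "disc_one B"
    and f_monic: "lead_coeff f = 1" and f_deg: "degree f = 2*n+2"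
    and f_sep: "coprime f (pderiv f)"
  shows "(\<exists>\<phi>. bij_betw \<phi> (V_f B f // PO_conj B) (split_alphas f // ksq_class_rel f) \<and>
            (\<forall>T. corresponds B f T 1 \<longrightarrow> \<phi> (PO_conj B `` {T}) = ksq_class_rel f `` {1}))
       \<and> (\<forall>T1 T2 a1 a2. T1 \<in> V_f B f \<longrightarrow> T2 \<in> V_f B f \<longrightarrow>
            L_unit f a1 \<longrightarrow> norm_trivial f a1 \<longrightarrow> L_unit f a2 \<longrightarrow> norm_trivial f a2 \<longrightarrow>
            corresponds B f T1 a1 \<longrightarrow> corresponds B f T2 a2 \<longrightarrow>
            ((T1, T2) \<in> PO_conj B \<longleftrightarrow> (a1, a2) \<in> ksq_class_rel f))"
proof -
  interpret separable_quotient f "2*n+2"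
    by unfold_locales (use f_monic f_deg f_sep in auto)
  have detB: "det B \<noteq> 0" using U_split by (auto simp: split_form_def Let_def)
  have alpha: "a \<in> split_alphas f" if "corresponds B f T a" for T a
    using corresponds_imp_unit[OF B detB that] corresponds_imp_split[OF B U_split that]
      split_imp_norm_trivial[OF char] by (auto simp: split_alphas_def)
  have V_carrier: "T \<in> carrier_mat (2*n+2) (2*n+2)" if "T \<in> V_f B f" for T
    using that B by (auto simp: V_f_def)
  have "\<exists>\<phi>. bij_betw \<phi> (V_f B f // PO_conj B) (split_alphas f // ksq_class_rel f) \<and>
      (\<forall>T\<in>V_f B f. \<forall>a\<in>split_alphas f. corresponds B f T a \<longrightarrow>
        \<phi> (PO_conj B `` {T}) = ksq_class_rel f `` {a})"
  proof (rule quotient_bij_betw)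
    show "\<exists>a\<in>split_alphas f. corresponds B f T a" if "T \<in> V_f B f" for T
      using V_f_imp_exists_corresponds[OF B that] alpha by blast
    show "\<exists>T\<in>V_f B f. corresponds B f T a" if "a \<in> split_alphas f" for a
      using split_imp_exists_corresponds[OF char B U_split] corresponds_in_V_f[OF B] that
      by (force simp: split_alphas_def)
    show "PO_conj B `` {T} = PO_conj B `` {T'} \<longleftrightarrow> ksq_class_rel f `` {a} = ksq_class_rel f `` {a'}"
      if "T \<in> V_f B f" "T' \<in> V_f B f" "a \<in> split_alphas f" "a' \<in> split_alphas f"
        "corresponds B f T a" "corresponds B f T' a'" for T T' a a'
      using that PO_conj_iff_ksq_class_rel[OF B, of a a' T T']
      by (simp add: PO_conj_class_eq_iff[OF B V_carrier V_carrier] ksq_class_eq_iff split_alphas_def)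
  qed
  \<comment> \<open>The distinguished orbit is the instance a = 1; that 1 lies in
    \<open>split_alphas f\<close> is supplied by the operator T corresponding to it.\<close>
  then show ?thesis
    using corresponds_in_V_f[OF B] alpha PO_conj_iff_ksq_class_rel[OF B] by blast
qed

end
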